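(* For programmable rotation angles and polynomial depth, the brickwork circuit family on an open chain defined in the context is universal for quantum computation. That is, there is a polynomial $r$ such that for every even $n$ and every $n$-qubit unitary $V$ that is a product of $s$ one- and two-qubit gates, there exist a depth $L\le r(n,s)$ and a choice of all rotation angles such that the corresponding depth-$L$ circuit of the family equals $V$ up to a global phase.
   Context: Let $n$ be even and label the qubits $1,\dots,n$ on an open chain. Define the controlled-$Z$ layers $$\mathrm{CZ}_{\mathrm e}=\mathrm{CZ}_{1,2}\mathrm{CZ}_{3,4}\cdots\mathrm{CZ}_{n-1,n},\qquad \mathrm{CZ}_{\mathrm o}=\mathrm{CZ}_{2,3}\mathrm{CZ}_{4,5}\cdots\mathrm{CZ}_{n-2,n-1}.$$ The circuits of the family apply, in time order, the gate sequence $$H^{\otimes n},\ \mathrm{CZ}_{\mathrm e},\ \mathcal R_Z,\ H^{\otimes n},\ \mathrm{CZ}_{\mathrm o},\ \mathcal R_Z,\ H^{\otimes n},\ \mathrm{CZ}_{\mathrm e},\ \mathcal R_Z,\ \dots$$ where $H$ is the Hadamard gate and each $\mathcal R_Z$ denotes a layer of single-qubit rotations $\bigotimes_{i=1}^n e^{i\alpha_{i,t}Z_i}$, whose real angles $\alpha_{i,t}$ ($i$ the qubit, $t$ the index of the rotation layer) can be chosen freely and independently (programmable), including the value $0$. The depth is the number of ($H^{\otimes n}$, $\mathrm{CZ}$, $\mathcal R_Z$) rounds. *)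

theory Defs
  imports
    Complex_Main
    "HOL-Computational_Algebra.Polynomial"
    "Jordan_Normal_Form.Schur_Decomposition"
begin

text \<open>
  Operators on \<open>n\<close> qubits are complex matrices of dimension \<open>2 ^ n\<close>.  The qubits are numbered
  \<open>1, \<dots>, n\<close>, and qubit \<open>1\<close> is the leftmost tensor factor: a basis index \<open>x < 2 ^ n\<close> denotes
  the computational basis state \<open>|x\<^sub>1 \<dots> x\<^sub>n\<rangle>\<close> whose labels are the binary digits of \<open>x\<close>, most
  significant digit first.
\<close>

definition qubit_val :: "nat \<Rightarrow> nat \<Rightarrow> nat \<Rightarrow> nat" where
  "qubit_val n x q = of_bool (bit x (n - q))"

text \<open>The number with binary digits \<open>x\<^sub>q\<close>, for \<open>q\<close> running through the list \<open>qs\<close>.\<close>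

definition sub_index :: "nat \<Rightarrow> nat list \<Rightarrow> nat \<Rightarrow> nat" where
  "sub_index n qs x = foldl (\<lambda>k q. 2 * k + qubit_val n x q) 0 qs"

text \<open>
  The operator on \<open>n\<close> qubits that applies \<open>U\<close>, of dimension \<open>2 ^ length qs\<close>, to the qubits listed
  in \<open>qs\<close> (in this order) and the identity to all others.
\<close>

definition on_qubits :: "nat \<Rightarrow> nat list \<Rightarrow> complex mat \<Rightarrow> complex mat" where
  "on_qubits n qs U = mat (2 ^ n) (2 ^ n) (\<lambda>(x, y).
     if \<forall>q \<in> {1..n} - set qs. qubit_val n x q = qubit_val n y q
     then U $$ (sub_index n qs x, sub_index n qs y) else 0)"

definition unitary_mat :: "nat \<Rightarrow> complex mat \<Rightarrow> bool" where
  "unitary_mat d U \<longleftrightarrow> U \<in> carrier_mat d d \<and> mat_adjoint U * U = 1\<^sub>m d \<and> U * mat_adjoint U = 1\<^sub>m d"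

definition mat_prod_list :: "nat \<Rightarrow> complex mat list \<Rightarrow> complex mat" where
  "mat_prod_list d Ms = foldr (*) Ms (1\<^sub>m d)"

text \<open>The two qubits of a two-qubit gate are arbitrary; they need not be neighbours on the chain.\<close>

definition one_or_two_qubit_gate :: "nat \<Rightarrow> complex mat \<Rightarrow> bool" where
  "one_or_two_qubit_gate n G \<longleftrightarrow>
     (\<exists>i U. i \<in> {1..n} \<and> unitary_mat 2 U \<and> G = on_qubits n [i] U) \<or>
     (\<exists>i j U. i \<in> {1..n} \<and> j \<in> {1..n} \<and> i \<noteq> j \<and> unitary_mat 4 U \<and> G = on_qubits n [i, j] U)"

definition hadamard :: "complex mat" where
  "hadamard = complex_of_real (1 / sqrt 2) \<cdot>\<^sub>m mat_of_rows_list 2 [[1, 1], [1, - 1]]"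

text \<open>\<open>e\<^bsup>i\<alpha>Z\<^esup>\<close> with \<open>Z = diag(1, -1)\<close>.\<close>

definition z_rotation :: "real \<Rightarrow> complex mat" where
  "z_rotation \<alpha> = mat_of_rows_list 2 [[exp (\<i> * of_real \<alpha>), 0], [0, exp (- \<i> * of_real \<alpha>)]]"

definition controlled_z :: "complex mat" where
  "controlled_z = mat_of_rows_list 4 [[1, 0, 0, 0], [0, 1, 0, 0], [0, 0, 1, 0], [0, 0, 0, - 1]]"

text \<open>
  A tensor product \<open>U\<^sub>1 \<otimes> \<dots> \<otimes> U\<^sub>n\<close> of one-qubit operators is the product of the (commuting)
  operators that apply \<open>U\<^sub>i\<close> to qubit \<open>i\<close>.
\<close>

definition h_layer :: "nat \<Rightarrow> complex mat" where
  "h_layer n = mat_prod_list (2 ^ n) (map (\<lambda>i. on_qubits n [i] hadamard) [1..<n + 1])"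

definition rz_layer :: "nat \<Rightarrow> (nat \<Rightarrow> real) \<Rightarrow> complex mat" where
  "rz_layer n \<alpha> = mat_prod_list (2 ^ n) (map (\<lambda>i. on_qubits n [i] (z_rotation (\<alpha> i))) [1..<n + 1])"

text \<open>For even \<open>n\<close>: the pairs \<open>(1,2), (3,4), \<dots>, (n-1,n)\<close>.\<close>

definition cz_e_layer :: "nat \<Rightarrow> complex mat" where
  "cz_e_layer n = mat_prod_list (2 ^ n)
     (map (\<lambda>k. on_qubits n [2 * k - 1, 2 * k] controlled_z) [1..<n div 2 + 1])"

text \<open>For even \<open>n\<close>: the pairs \<open>(2,3), (4,5), \<dots>, (n-2,n-1)\<close>; there are none if \<open>n = 2\<close>.\<close>

definition cz_o_layer :: "nat \<Rightarrow> complex mat" where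
  "cz_o_layer n = mat_prod_list (2 ^ n)
     (map (\<lambda>k. on_qubits n [2 * k, 2 * k + 1] controlled_z) [1..<n div 2])"

definition cz_layer :: "nat \<Rightarrow> nat \<Rightarrow> complex mat" where
  "cz_layer n t = (if odd t then cz_e_layer n else cz_o_layer n)"

text \<open>
  The depth-\<open>L\<close> circuit with angles \<open>\<alpha> i t\<close> (qubit \<open>i\<close>, round \<open>t = 1, \<dots>, L\<close>).  Gates applied
  later in time stand further to the left.
\<close>

fun brickwork :: "nat \<Rightarrow> (nat \<Rightarrow> nat \<Rightarrow> real) \<Rightarrow> nat \<Rightarrow> complex mat" where
  "brickwork n \<alpha> 0 = 1\<^sub>m (2 ^ n)"
| "brickwork n \<alpha> (Suc t) =
     rz_layer n (\<lambda>i. \<alpha> i (Suc t)) * cz_layer n (Suc t) * h_layer n * brickwork n \<alpha> t"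

text \<open>
  Polynomials in two variables are polynomials whose coefficients are polynomials: the outer
  variable takes the value \<open>y\<close>, the inner one the value \<open>x\<close>.
\<close>

definition eval_poly2 :: "real poly poly \<Rightarrow> real \<Rightarrow> real \<Rightarrow> real" where
  "eval_poly2 r x y = poly (poly r [:y:]) x"

end

theory Submission
  imports Defs
begin

text \<open>
  Let \<open>T\<close> be the circuit of two rounds with vanishing angles.  Conjugation with Hadamard gates on the
  even qubits turns \<open>T\<close> into a product of CNOT gates that permutes the basis states by a unipotent
  triangular matrix \<open>1 + N\<close> over the field with two elements.  Since \<open>(1 + N)\<close> to the power \<open>2 ^ k\<close> is
  \<open>1 + N ^ (2 ^ k)\<close>, the circuit \<open>T\<close> has order at most \<open>2 * n\<close>, so its inverse is available as well.
  Switching on the angles of a single round therefore isolates the rotations about \<open>Z\<close> and \<open>X\<close> of a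
  single qubit, hence all one-qubit gates, and conjugating such rotations with \<open>T\<close> isolates the
  controlled-Z gate of a single pair of neighbours.  Swaps carry these gates to arbitrary pairs of
  qubits, and a two-qubit gate is a product of six Givens rotations and a diagonal gate.
\<close>

subsection \<open>Operators on one and two qubits\<close>

text \<open>The Hadamard and controlled-Z layers cannot be switched off. Even with vanishing angles
  they act on all qubits, so a chosen gate appears only after everything around it is cancelled;
  this needs inverses, although circuits only run forward. The inverse of a fixed circuit need not
  be a small power of it, so the linear period is the fact on which the polynomial bound rests. It
  comes from the alternation of the layers: every pair of neighbours contains exactly one even
  qubit. In \<open>cz_o_layer\<close> it is the first of the pair, in \<open>cz_e_layer\<close> the
  second, but the latter layer stands between two Hadamard layers, which exchanges the roles. Hence
  all CNOT gates point in the same direction. A conjugated rotation contains the controlled-Z gate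
  twice and equals \<open>exp(i a X Z)\<close> on two neighbours; at \<open>a = pi / 4\<close> it is
  a single controlled-Z gate up to one-qubit gates and a phase. The cost is linear in
  \<open>n\<close> for a rotation, quadratic for neighbours and cubic for an arbitrary pair.\<close>

lemma qubit_index_exists: "\<exists>z < 2 ^ n. \<forall>q \<in> {1..n}. qubit_val n z q = of_bool (P q)"
proof -
  \<comment> \<open>\<open>horner_sum\<close> expects the least significant digit first, while qubit
    \<open>q\<close> is bit \<open>n - q\<close>.\<close>
  define z :: nat where "z = horner_sum of_bool 2 (map (\<lambda>k. P (n - k)) [0..<n])"
  have "z < 2 ^ length (map (\<lambda>k. P (n - k)) [0..<n])"
    unfolding z_def by (rule horner_sum_of_bool_2_less)
  moreover have "qubit_val n z q = of_bool (P q)" if "q \<in> {1..n}" for q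
    using that by (auto simp: z_def qubit_val_def bit_horner_sum_bit_iff)
  ultimately show ?thesis by (intro exI[of _ z]) simp
qed

lemma qubit_index_eqI:
  assumes "x < 2 ^ n" "y < 2 ^ n" "\<And>q. q \<in> {1..n} \<Longrightarrow> qubit_val n x q = qubit_val n y q"
  shows "x = y"
proof (rule bit_eqI)
  fix k
  show "bit x k = bit y k"
  proof (cases "k < n")
    case True
    then show ?thesis using assms(3)[of "n - k"]
      by (auto simp: qubit_val_def of_bool_eq_iff)
  next
    case False
    have "take_bit n x = x" "take_bit n y = y"
      using assms by (auto simp: take_bit_nat_eq_self)
    then show ?thesis using False by (metis bit_take_bit_iff)
  qed
qed

lemma sub_index_Nil [simp]: "sub_index n [] x = 0"
  by (simp add: sub_index_def)

lemma sub_index_snoc [simp]: "sub_index n (qs @ [q]) x = 2 * sub_index n qs x + qubit_val n x q"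
  by (simp add: sub_index_def)

lemma sub_index_1: "sub_index n [i] x = qubit_val n x i"
  by (simp add: sub_index_def)

lemma sub_index_2: "sub_index n [i, j] x = 2 * qubit_val n x i + qubit_val n x j"
  by (simp add: sub_index_def)

lemma qubit_val_less [simp]: "qubit_val n x q < 2"
  by (simp add: qubit_val_def)

lemma sub_index_less: "sub_index n qs x < 2 ^ length qs"
proof (induction qs rule: rev_induct)
  case (snoc q qs)
  have "sub_index n qs x + 1 \<le> 2 ^ length qs" using snoc by simp
  then have "2 * sub_index n qs x + 2 \<le> 2 * 2 ^ length qs" by linarith
  moreover have "sub_index n (qs @ [q]) x < 2 * sub_index n qs x + 2"
    using qubit_val_less[of n x q] by (simp only: sub_index_snoc)
  ultimately have "sub_index n (qs @ [q]) x < 2 * 2 ^ length qs" by linarith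
  then show ?case by (simp del: sub_index_snoc)
qed simp

lemma sub_index_cong:
  "(\<And>q. q \<in> set qs \<Longrightarrow> qubit_val n x q = qubit_val n y q) \<Longrightarrow> sub_index n qs x = sub_index n qs y"
  by (induction qs rule: rev_induct) auto

lemma sub_index_inj:
  "sub_index n qs x = sub_index n qs y \<Longrightarrow> q \<in> set qs \<Longrightarrow> qubit_val n x q = qubit_val n y q"
proof (induction qs rule: rev_induct)
  case (snoc p qs)
  from snoc.prems(1) have "2 * sub_index n qs x + qubit_val n x p = 2 * sub_index n qs y + qubit_val n y p"
    by simp
  with qubit_val_less[of n x p] qubit_val_less[of n y p]
  have "sub_index n qs x = sub_index n qs y" "qubit_val n x p = qubit_val n y p"
    by presburger+
  with snoc show ?case by auto
qed simp

text \<open>Together with \<open>sub_index_inj\<close> this makes the indices that agree with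
  \<open>x\<close> off \<open>qs\<close> a copy of the index range of the small operator.
  Distinctness lets each listed qubit receive its digit without overwriting another.\<close>

lemma sub_index_surj:
  assumes "distinct qs" "set qs \<subseteq> {1..n}" "k < 2 ^ length qs"
  shows "\<exists>z < 2 ^ n. sub_index n qs z = k \<and>
           (\<forall>q \<in> {1..n} - set qs. qubit_val n z q = qubit_val n x q)"
  using assms
proof (induction qs arbitrary: k rule: rev_induct)
  case Nil
  show ?case using Nil qubit_index_exists[of n "\<lambda>q. bit x (n - q)"]
    by (simp add: qubit_val_def[of n x])
next
  case (snoc p qs)
  from snoc.prems have "k div 2 < 2 ^ length qs" by auto
  then obtain z where z: "z < 2 ^ n" "sub_index n qs z = k div 2"
    "\<forall>q \<in> {1..n} - set qs. qubit_val n z q = qubit_val n x q"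
    using snoc.IH[of "k div 2"] snoc.prems by auto
  \<comment> \<open>The lowest digit of \<open>k\<close> goes to the last qubit of the list; all
    other qubits keep the digits found for \<open>k div 2\<close>.\<close>
  obtain w where w: "w < 2 ^ n"
    "\<forall>q \<in> {1..n}. qubit_val n w q = of_bool (if q = p then odd k else bit z (n - q))"
    using qubit_index_exists[of n "\<lambda>q. if q = p then odd k else bit z (n - q)"] by blast
  have "sub_index n qs w = sub_index n qs z"
  proof (rule sub_index_cong)
    fix q assume "q \<in> set qs"
    moreover from this have "q \<in> {1..n}" "q \<noteq> p" using snoc.prems by auto
    ultimately show "qubit_val n w q = qubit_val n z q" using w by (simp add: qubit_val_def[of n z])
  qed
  moreover have "qubit_val n w p = k mod 2"
    using w snoc.prems by (auto simp: odd_iff_mod_2_eq_one)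
  ultimately have "sub_index n (qs @ [p]) w = k" using z by simp
  moreover have "\<forall>q \<in> {1..n} - set (qs @ [p]). qubit_val n w q = qubit_val n x q"
    using w z by (simp add: qubit_val_def[of n z])
  ultimately show ?case using w by blast
qed

section \<open>Products of operators acting on a few qubits\<close>

lemma on_qubits_carrier [simp]: "on_qubits n qs U \<in> carrier_mat (2 ^ n) (2 ^ n)"
  by (simp add: on_qubits_def)

lemma on_qubits_dim [simp]:
  "dim_row (on_qubits n qs U) = 2 ^ n" "dim_col (on_qubits n qs U) = 2 ^ n"
  by (simp_all add: on_qubits_def)

lemma on_qubits_index:
  "x < 2 ^ n \<Longrightarrow> y < 2 ^ n \<Longrightarrow> on_qubits n qs U $$ (x, y) =
     (if \<forall>q \<in> {1..n} - set qs. qubit_val n x q = qubit_val n y q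
      then U $$ (sub_index n qs x, sub_index n qs y) else 0)"
  by (simp add: on_qubits_def)

lemma on_qubits_index_eq_0:
  assumes "x < 2 ^ n" "y < 2 ^ n" "\<not> (\<forall>q \<in> {1..n} - set qs. qubit_val n x q = qubit_val n y q)"
  shows "on_qubits n qs U $$ (x, y) = 0"
  unfolding on_qubits_index[OF assms(1,2)] by (rule if_not_P[OF assms(3)])

lemma on_qubits_index_agree:
  assumes "x < 2 ^ n" "y < 2 ^ n" "\<forall>q \<in> {1..n} - set qs. qubit_val n x q = qubit_val n y q"
  shows "on_qubits n qs U $$ (x, y) = U $$ (sub_index n qs x, sub_index n qs y)"
  unfolding on_qubits_index[OF assms(1,2)] by (rule if_P[OF assms(3)])

lemma mult_mat_index:
  assumes "A \<in> carrier_mat m k" "B \<in> carrier_mat k l" "x < m" "y < l"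
  shows "(A * B) $$ (x, y) = (\<Sum>z < k. A $$ (x, z) * B $$ (z, y))"
  using assms by (auto simp: scalar_prod_def atLeast0LessThan intro!: sum.cong)

text \<open>Row \<open>x\<close> of the left factor is supported on the indices that agree with
  \<open>x\<close> off \<open>qs\<close>. As \<open>sub_index\<close> maps them bijectively onto the
  small index range, the sum over them is an entry of \<open>A * B\<close>. If \<open>x\<close> and
  \<open>y\<close> disagree off \<open>qs\<close>, every term vanishes.\<close>

lemma on_qubits_mult:
  assumes qs: "distinct qs" "set qs \<subseteq> {1..n}"
    and A: "A \<in> carrier_mat (2 ^ length qs) (2 ^ length qs)"
    and B: "B \<in> carrier_mat (2 ^ length qs) (2 ^ length qs)"
  shows "on_qubits n qs A * on_qubits n qs B = on_qubits n qs (A * B)"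
proof (rule eq_matI)
  fix x y assume "x < dim_row (on_qubits n qs (A * B))" "y < dim_col (on_qubits n qs (A * B))"
  then have x: "x < 2 ^ n" and y: "y < 2 ^ n" by auto
  define Z where "Z = {z. z < 2 ^ n \<and> (\<forall>q \<in> {1..n} - set qs. qubit_val n z q = qubit_val n x q)}"
  have bij: "bij_betw (sub_index n qs) Z {..<2 ^ length qs}"
    unfolding bij_betw_def
  proof
    show "inj_on (sub_index n qs) Z"
    proof (rule inj_onI)
      fix z w assume *: "z \<in> Z" "w \<in> Z" "sub_index n qs z = sub_index n qs w"
      show "z = w"
      proof (rule qubit_index_eqI)
        show "z < 2 ^ n" "w < 2 ^ n" using * by (auto simp: Z_def)
        fix q assume "q \<in> {1..n}"
        then show "qubit_val n z q = qubit_val n w q"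
          using * sub_index_inj[OF *(3)] by (cases "q \<in> set qs") (auto simp: Z_def)
      qed
    qed
    show "sub_index n qs ` Z = {..<2 ^ length qs}"
    proof
      show "sub_index n qs ` Z \<subseteq> {..<2 ^ length qs}" using sub_index_less by auto
      show "{..<2 ^ length qs} \<subseteq> sub_index n qs ` Z"
      proof
        fix k assume "k \<in> {..<2 ^ length qs :: nat}"
        then obtain z where "z \<in> Z" "sub_index n qs z = k"
          using sub_index_surj[OF qs, of k x] unfolding Z_def by auto
        then show "k \<in> sub_index n qs ` Z" by blast
      qed
    qed
  qed
  have "(on_qubits n qs A * on_qubits n qs B) $$ (x, y) =
     (\<Sum>z < 2 ^ n. on_qubits n qs A $$ (x, z) * on_qubits n qs B $$ (z, y))"
    using x y by (intro mult_mat_index) auto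
  also have "\<dots> = (\<Sum>z \<in> Z. on_qubits n qs A $$ (x, z) * on_qubits n qs B $$ (z, y))"
  proof (rule sum.mono_neutral_right)
    show "Z \<subseteq> {..<2 ^ n}" by (auto simp: Z_def)
    show "\<forall>z \<in> {..<2 ^ n} - Z. on_qubits n qs A $$ (x, z) * on_qubits n qs B $$ (z, y) = 0"
    proof
      fix z assume z: "z \<in> {..<2 ^ n} - Z"
      then obtain q where "q \<in> {1..n} - set qs" "qubit_val n z q \<noteq> qubit_val n x q"
        unfolding Z_def by blast
      then have "\<not> (\<forall>q \<in> {1..n} - set qs. qubit_val n x q = qubit_val n z q)" by metis
      then have "on_qubits n qs A $$ (x, z) = 0"
        using on_qubits_index_eq_0[OF x, of z] z by blast
      then show "on_qubits n qs A $$ (x, z) * on_qubits n qs B $$ (z, y) = 0" by simp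
    qed
  qed simp
  also have "\<dots> = on_qubits n qs (A * B) $$ (x, y)"
  proof (cases "\<forall>q \<in> {1..n} - set qs. qubit_val n x q = qubit_val n y q")
    case True
    have "(\<Sum>z \<in> Z. on_qubits n qs A $$ (x, z) * on_qubits n qs B $$ (z, y)) =
      (\<Sum>z \<in> Z. A $$ (sub_index n qs x, sub_index n qs z) * B $$ (sub_index n qs z, sub_index n qs y))"
    proof (rule sum.cong[OF refl])
      fix z assume "z \<in> Z"
      then have z: "z < 2 ^ n" and xz: "\<forall>q \<in> {1..n} - set qs. qubit_val n x q = qubit_val n z q"
        unfolding Z_def by simp_all
      have zy: "\<forall>q \<in> {1..n} - set qs. qubit_val n z q = qubit_val n y q"
      proof
        fix q assume q: "q \<in> {1..n} - set qs"
        show "qubit_val n z q = qubit_val n y q" using bspec[OF xz q] bspec[OF True q] by simp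
      qed
      show "on_qubits n qs A $$ (x, z) * on_qubits n qs B $$ (z, y) =
        A $$ (sub_index n qs x, sub_index n qs z) * B $$ (sub_index n qs z, sub_index n qs y)"
        unfolding on_qubits_index_agree[OF x z xz] on_qubits_index_agree[OF z y zy] ..
    qed
    also have "\<dots> = (\<Sum>k < 2 ^ length qs. A $$ (sub_index n qs x, k) * B $$ (k, sub_index n qs y))"
      using bij by (rule sum.reindex_bij_betw)
    also have "\<dots> = (A * B) $$ (sub_index n qs x, sub_index n qs y)"
      using A B by (intro mult_mat_index[symmetric]) (auto simp: sub_index_less)
    finally show ?thesis unfolding on_qubits_index_agree[OF x y True] .
  next
    case False
    have "on_qubits n qs A $$ (x, z) * on_qubits n qs B $$ (z, y) = 0" if "z \<in> Z" for z
    proof -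
      have "\<not> (\<forall>q \<in> {1..n} - set qs. qubit_val n z q = qubit_val n y q)"
      proof
        assume *: "\<forall>q \<in> {1..n} - set qs. qubit_val n z q = qubit_val n y q"
        have "\<forall>q \<in> {1..n} - set qs. qubit_val n z q = qubit_val n x q" using that by (simp add: Z_def)
        with * have "\<forall>q \<in> {1..n} - set qs. qubit_val n x q = qubit_val n y q" by metis
        with False show False ..
      qed
      then have "on_qubits n qs B $$ (z, y) = 0"
        using on_qubits_index_eq_0[OF _ y, of z] that unfolding Z_def by blast
      then show ?thesis by simp
    qed
    then have "(\<Sum>z \<in> Z. on_qubits n qs A $$ (x, z) * on_qubits n qs B $$ (z, y)) = 0" by simp
    then show ?thesis unfolding on_qubits_index_eq_0[OF x y False] .
  qed
  finally show "(on_qubits n qs A * on_qubits n qs B) $$ (x, y) = on_qubits n qs (A * B) $$ (x, y)" .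
qed auto

lemma qubit_index_eqI_on:
  assumes "x < 2 ^ n" "y < 2 ^ n" "\<forall>q \<in> {1..n} - set qs. qubit_val n x q = qubit_val n y q"
    and "sub_index n qs x = sub_index n qs y"
  shows "x = y"
proof (rule qubit_index_eqI[OF assms(1,2)])
  fix q assume "q \<in> {1..n}"
  then show "qubit_val n x q = qubit_val n y q"
    using assms(3) sub_index_inj[OF assms(4), of q] by (cases "q \<in> set qs") auto
qed

lemma on_qubits_one: "on_qubits n qs (1\<^sub>m (2 ^ length qs)) = 1\<^sub>m (2 ^ n)"
proof (rule eq_matI)
  fix x y assume "x < dim_row (1\<^sub>m (2 ^ n) :: complex mat)" "y < dim_col (1\<^sub>m (2 ^ n) :: complex mat)"
  then have x: "x < 2 ^ n" and y: "y < 2 ^ n" by auto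
  show "on_qubits n qs (1\<^sub>m (2 ^ length qs)) $$ (x, y) = 1\<^sub>m (2 ^ n) $$ (x, y)"
  proof (cases "\<forall>q \<in> {1..n} - set qs. qubit_val n x q = qubit_val n y q")
    case True
    then show ?thesis
      unfolding on_qubits_index_agree[OF x y True]
      using qubit_index_eqI_on[OF x y True] x y sub_index_less[of n qs]
      by (cases "x = y") auto
  next
    case False
    then show ?thesis
      unfolding on_qubits_index_eq_0[OF x y False] using x y by auto
  qed
qed auto

lemma on_qubits_smult:
  assumes "A \<in> carrier_mat (2 ^ length qs) (2 ^ length qs)"
  shows "on_qubits n qs (c \<cdot>\<^sub>m A) = c \<cdot>\<^sub>m on_qubits n qs A"
  using assms by (intro eq_matI) (auto simp: on_qubits_index sub_index_less)

text \<open>A contributing intermediate index must agree with \<open>x\<close> off \<open>ps\<close>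
  and with \<open>y\<close> off \<open>qs\<close>, which leaves the single index \<open>w\<close>.
  The resulting entry is symmetric in the two factors, whence operators on disjoint qubits
  commute.\<close>

lemma on_qubits_disjoint_mult_index:
  assumes ps: "set ps \<subseteq> {1..n}" and qs: "set qs \<subseteq> {1..n}" and disj: "set ps \<inter> set qs = {}"
    and x: "x < 2 ^ n" and y: "y < 2 ^ n"
  shows "(on_qubits n ps A * on_qubits n qs B) $$ (x, y) =
    (if \<forall>q \<in> {1..n} - (set ps \<union> set qs). qubit_val n x q = qubit_val n y q
     then A $$ (sub_index n ps x, sub_index n ps y) * B $$ (sub_index n qs x, sub_index n qs y)
     else 0)"
proof -
  obtain w where w: "w < 2 ^ n"
    "\<forall>q \<in> {1..n}. qubit_val n w q = of_bool (if q \<in> set ps then bit y (n - q) else bit x (n - q))"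
    using qubit_index_exists[of n "\<lambda>q. if q \<in> set ps then bit y (n - q) else bit x (n - q)"] by blast
  have wv: "qubit_val n w q = (if q \<in> set ps then qubit_val n y q else qubit_val n x q)"
    if "q \<in> {1..n}" for q
    using w that by (auto simp: qubit_val_def)
  let ?f = "\<lambda>z. on_qubits n ps A $$ (x, z) * on_qubits n qs B $$ (z, y)"
  have "(on_qubits n ps A * on_qubits n qs B) $$ (x, y) = (\<Sum>z < 2 ^ n. ?f z)"
    using x y by (intro mult_mat_index) auto
  also have "\<dots> = (\<Sum>z \<in> {w}. ?f z)"
  proof (rule sum.mono_neutral_right)
    show "\<forall>z \<in> {..<2 ^ n} - {w}. ?f z = 0"
    proof
      fix z assume z: "z \<in> {..<2 ^ n} - {w}"
      then obtain q where q: "q \<in> {1..n}" "qubit_val n z q \<noteq> qubit_val n w q"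
        using w qubit_index_eqI[of z n w] by auto
      show "?f z = 0"
      proof (cases "q \<in> set ps")
        case True
        then have "\<not> (\<forall>q \<in> {1..n} - set qs. qubit_val n z q = qubit_val n y q)"
          using q wv[of q] disj by auto
        then have "on_qubits n qs B $$ (z, y) = 0"
          using on_qubits_index_eq_0[OF _ y, of z] z by blast
        then show ?thesis by simp
      next
        case False
        then have "\<not> (\<forall>q \<in> {1..n} - set ps. qubit_val n x q = qubit_val n z q)"
          using q wv[of q] by (metis Diff_iff)
        then have "on_qubits n ps A $$ (x, z) = 0"
          using on_qubits_index_eq_0[OF x, of z] z by blast
        then show ?thesis by simp
      qed
    qed
  qed (use w in auto)
  also have "\<dots> = ?f w" by simp
  finally have *: "(on_qubits n ps A * on_qubits n qs B) $$ (x, y) = ?f w" .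
  have "sub_index n ps w = sub_index n ps y"
    by (rule sub_index_cong) (use wv ps in auto)
  moreover have "sub_index n qs w = sub_index n qs x"
  proof (rule sub_index_cong)
    fix q assume "q \<in> set qs"
    moreover from this have "q \<in> {1..n}" "q \<notin> set ps" using qs disj by auto
    ultimately show "qubit_val n w q = qubit_val n x q" using wv[of q] by simp
  qed
  moreover have xw: "(\<forall>q \<in> {1..n} - set ps. qubit_val n x q = qubit_val n w q)" using wv by simp
  moreover have iff: "(\<forall>q \<in> {1..n} - set qs. qubit_val n w q = qubit_val n y q) \<longleftrightarrow>
     (\<forall>q \<in> {1..n} - (set ps \<union> set qs). qubit_val n x q = qubit_val n y q)"
    (is "?l \<longleftrightarrow> ?r")
  proof
    assume l: ?l
    show ?r
    proof
      fix q assume "q \<in> {1..n} - (set ps \<union> set qs)"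
      then show "qubit_val n x q = qubit_val n y q" using l wv[of q] by simp
    qed
  next
    assume r: ?r
    show ?l
    proof
      fix q assume "q \<in> {1..n} - set qs"
      then show "qubit_val n w q = qubit_val n y q" using r wv[of q] by (cases "q \<in> set ps") simp_all
    qed
  qed
  ultimately show ?thesis
    unfolding * on_qubits_index_agree[OF x w(1) xw] on_qubits_index[OF w(1) y] iff by simp
qed

lemma on_qubits_commute:
  assumes "set ps \<subseteq> {1..n}" "set qs \<subseteq> {1..n}" "set ps \<inter> set qs = {}"
  shows "on_qubits n ps A * on_qubits n qs B = on_qubits n qs B * on_qubits n ps A"
proof (rule eq_matI)
  fix x y
  assume "x < dim_row (on_qubits n qs B * on_qubits n ps A)" "y < dim_col (on_qubits n qs B * on_qubits n ps A)"
  then have "x < 2 ^ n" "y < 2 ^ n" by auto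
  moreover have "set qs \<inter> set ps = {}" using assms by auto
  ultimately show "(on_qubits n ps A * on_qubits n qs B) $$ (x, y) = (on_qubits n qs B * on_qubits n ps A) $$ (x, y)"
    using assms by (simp only: on_qubits_disjoint_mult_index Un_commute[of "set qs" "set ps"] mult.commute)
qed auto

lemma square_mult_carrier [simp]:
  "A \<in> carrier_mat d d \<Longrightarrow> B \<in> carrier_mat d d \<Longrightarrow> A * B \<in> carrier_mat d d"
  by (rule mult_carrier_mat)

lemma square_one_mult [simp]:
  "A \<in> carrier_mat d d \<Longrightarrow> 1\<^sub>m d * A = (A :: complex mat)"
  "A \<in> carrier_mat d d \<Longrightarrow> A * 1\<^sub>m d = (A :: complex mat)"
  by simp_all

lemma square_mult_assoc:
  "A \<in> carrier_mat d d \<Longrightarrow> B \<in> carrier_mat d d \<Longrightarrow> C \<in> carrier_mat d d \<Longrightarrow> A * B * C = A * (B * C)"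
  by (rule assoc_mult_mat)

text \<open>The first factor owns the more significant digit, in accordance with
  \<open>sub_index n [i, j]\<close>.\<close>

definition kron2 :: "complex mat \<Rightarrow> complex mat \<Rightarrow> complex mat" where
  "kron2 A B = mat 4 4 (\<lambda>(r, c). A $$ (r div 2, c div 2) * B $$ (r mod 2, c mod 2))"

lemma kron2_carrier [simp]: "kron2 A B \<in> carrier_mat 4 4"
  by (simp add: kron2_def)

lemma kron2_dim [simp]: "dim_row (kron2 A B) = 4" "dim_col (kron2 A B) = 4"
  by (simp_all add: kron2_def)

lemma less_2_iff: "(k :: nat) < 2 \<longleftrightarrow> k = 0 \<or> k = 1" by auto

lemma less_4_cases: "(k :: nat) < 4 \<longleftrightarrow> k = 0 \<or> k = 1 \<or> k = 2 \<or> k = 3" by auto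

lemma on_qubits_kron2:
  assumes ij: "i \<in> {1..n}" "j \<in> {1..n}" "i \<noteq> j"
  shows "on_qubits n [i, j] (kron2 A B) = on_qubits n [i] A * on_qubits n [j] B"
proof (rule eq_matI)
  fix x y
  assume "x < dim_row (on_qubits n [i] A * on_qubits n [j] B)" "y < dim_col (on_qubits n [i] A * on_qubits n [j] B)"
  then have x: "x < 2 ^ n" and y: "y < 2 ^ n" by auto
  have less: "2 * qubit_val n z i + qubit_val n z j < 4" for z
    using qubit_val_less[of n z i] qubit_val_less[of n z j] by linarith
  have dm: "(2 * qubit_val n z i + qubit_val n z j) div 2 = qubit_val n z i"
    "(2 * qubit_val n z i + qubit_val n z j) mod 2 = qubit_val n z j" for z
    using qubit_val_less[of n z j] by simp_all
  have kr: "kron2 A B $$ (sub_index n [i, j] x, sub_index n [i, j] y) =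
    A $$ (qubit_val n x i, qubit_val n y i) * B $$ (qubit_val n x j, qubit_val n y j)"
    unfolding kron2_def sub_index_2 by (subst index_mat(1)[OF less less]) (simp only: prod.case dm)
  have "(on_qubits n [i] A * on_qubits n [j] B) $$ (x, y) =
    (if \<forall>q \<in> {1..n} - {i, j}. qubit_val n x q = qubit_val n y q
     then A $$ (qubit_val n x i, qubit_val n y i) * B $$ (qubit_val n x j, qubit_val n y j) else 0)"
    using on_qubits_disjoint_mult_index[of "[i]" n "[j]" x y A B] ij x y
    by (simp only: sub_index_1) simp
  also have "\<dots> = on_qubits n [i, j] (kron2 A B) $$ (x, y)"
    using x y by (simp only: on_qubits_index kr) simp
  finally show "on_qubits n [i, j] (kron2 A B) $$ (x, y) = (on_qubits n [i] A * on_qubits n [j] B) $$ (x, y)"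
    by (rule sym)
qed auto

subsection \<open>Hadamard gates and diagonal operators\<close>

lemma sum_lessThan_2: "(\<Sum>z < (2 :: nat). f z) = f 0 + f 1"
  by (simp add: eval_nat_numeral)

lemma sum_lessThan_4: "(\<Sum>z < (4 :: nat). f z) = f 0 + f 1 + f 2 + f 3"
  by (simp add: eval_nat_numeral)

lemma mult_mat_index_2:
  assumes "A \<in> carrier_mat 2 2" "B \<in> carrier_mat 2 2" "x < 2" "y < 2"
  shows "(A * B) $$ (x, y) = A $$ (x, 0) * B $$ (0, y) + A $$ (x, 1) * B $$ (1, y)"
  using mult_mat_index[OF assms] by (simp only: sum_lessThan_2)

lemma mult_mat_index_4:
  assumes "A \<in> carrier_mat 4 4" "B \<in> carrier_mat 4 4" "x < 4" "y < 4"
  shows "(A * B) $$ (x, y) = A $$ (x, 0) * B $$ (0, y) + A $$ (x, 1) * B $$ (1, y)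
    + A $$ (x, 2) * B $$ (2, y) + A $$ (x, 3) * B $$ (3, y)"
  using mult_mat_index[OF assms] by (simp only: sum_lessThan_4)

lemma eq_mat_2I:
  assumes "A \<in> carrier_mat 2 2" "B \<in> carrier_mat 2 2"
    "A $$ (0, 0) = B $$ (0, 0)" "A $$ (0, 1) = B $$ (0, 1)"
    "A $$ (1, 0) = B $$ (1, 0)" "A $$ (1, 1) = B $$ (1, 1)"
  shows "A = B"
  using assms by (intro eq_matI) (auto simp: less_2_iff)

lemma eq_mat_4I:
  assumes "A \<in> carrier_mat 4 4" "B \<in> carrier_mat 4 4"
    "\<And>r c. r \<in> {0, 1, 2, 3} \<Longrightarrow> c \<in> {0, 1, 2, 3} \<Longrightarrow> A $$ (r, c) = B $$ (r, c)"
  shows "A = B"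
  using assms(1,2) assms(3) by (intro eq_matI) (auto simp: less_4_cases)

lemma kron2_index:
  "r < 4 \<Longrightarrow> c < 4 \<Longrightarrow> kron2 A B $$ (r, c) = A $$ (r div 2, c div 2) * B $$ (r mod 2, c mod 2)"
  by (simp add: kron2_def)

lemma kron2_mult:
  assumes "A \<in> carrier_mat 2 2" "B \<in> carrier_mat 2 2" "C \<in> carrier_mat 2 2" "D \<in> carrier_mat 2 2"
  shows "kron2 A B * kron2 C D = kron2 (A * C) (B * D)"
proof (rule eq_matI)
  fix r c assume "r < dim_row (kron2 (A * C) (B * D))" "c < dim_col (kron2 (A * C) (B * D))"
  then have r: "r < 4" "r div 2 < 2" "r mod 2 < 2" and c: "c < 4" "c div 2 < 2" "c mod 2 < 2"
    by (auto simp: kron2_def)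
  have "(kron2 A B * kron2 C D) $$ (r, c) =
    (\<Sum>z < 4. (A $$ (r div 2, z div 2) * B $$ (r mod 2, z mod 2)) * (C $$ (z div 2, c div 2) * D $$ (z mod 2, c mod 2)))"
    using r c by (subst mult_mat_index[where m = 4 and k = 4 and l = 4]) (simp_all add: kron2_index)
  also have "\<dots> = (A * C) $$ (r div 2, c div 2) * (B * D) $$ (r mod 2, c mod 2)"
    using assms r c by (simp add: sum_lessThan_4 mult_mat_index_2 del: index_mult_mat) (simp add: algebra_simps)
  finally show "(kron2 A B * kron2 C D) $$ (r, c) = kron2 (A * C) (B * D) $$ (r, c)"
    using r c by (simp add: kron2_index del: index_mult_mat)
qed (auto simp: kron2_def)

lemma kron2_one: "kron2 (1\<^sub>m 2) (1\<^sub>m 2) = 1\<^sub>m 4"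
  by (rule eq_mat_4I) (auto simp: kron2_index)

lemma on_qubits_one_1: "on_qubits n [i] (1\<^sub>m 2) = 1\<^sub>m (2 ^ n)"
  using on_qubits_one[of n "[i]"] by simp

lemma on_qubits_one_2: "on_qubits n [i, j] (1\<^sub>m 4) = 1\<^sub>m (2 ^ n)"
  using on_qubits_one[of n "[i, j]"] by simp

text \<open>Pads a one-qubit gate to a pair, so that identities between gates on that pair reduce to
  4 by 4 matrices.\<close>

lemma on_qubits_first:
  assumes "i \<in> {1..n}" "j \<in> {1..n}" "i \<noteq> j"
  shows "on_qubits n [i] A = on_qubits n [i, j] (kron2 A (1\<^sub>m 2))"
  using on_qubits_kron2[OF assms, of A "1\<^sub>m 2"] by (simp add: on_qubits_one_1)

lemma on_qubits_second:
  assumes "i \<in> {1..n}" "j \<in> {1..n}" "i \<noteq> j"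
  shows "on_qubits n [j] A = on_qubits n [i, j] (kron2 (1\<^sub>m 2) A)"
  using on_qubits_kron2[OF assms, of "1\<^sub>m 2" A] by (simp add: on_qubits_one_1)

lemma on_qubits_mult_1:
  assumes "i \<in> {1..n}" "A \<in> carrier_mat 2 2" "B \<in> carrier_mat 2 2"
  shows "on_qubits n [i] A * on_qubits n [i] B = on_qubits n [i] (A * B)"
  using on_qubits_mult[of "[i]" n A B] assms by simp

lemma on_qubits_mult_2:
  assumes "i \<in> {1..n}" "j \<in> {1..n}" "i \<noteq> j" "A \<in> carrier_mat 4 4" "B \<in> carrier_mat 4 4"
  shows "on_qubits n [i, j] A * on_qubits n [i, j] B = on_qubits n [i, j] (A * B)"
  using on_qubits_mult[of "[i, j]" n A B] assms by simp

lemma mat_prod_list_Nil [simp]: "mat_prod_list d [] = 1\<^sub>m d"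
  and mat_prod_list_Cons [simp]: "mat_prod_list d (M # Ms) = M * mat_prod_list d Ms"
  by (simp_all add: mat_prod_list_def)

lemma mat_prod_list_carrier [simp]:
  "(\<And>M. M \<in> set Ms \<Longrightarrow> M \<in> carrier_mat d d) \<Longrightarrow> mat_prod_list d Ms \<in> carrier_mat d d"
  by (induction Ms) auto

lemma hadamard_carrier [simp]: "hadamard \<in> carrier_mat 2 2"
  by (auto simp: hadamard_def mat_of_rows_list_def)

lemma hadamard_index [simp]:
  "hadamard $$ (0, 0) = complex_of_real (1 / sqrt 2)"
  "hadamard $$ (0, Suc 0) = complex_of_real (1 / sqrt 2)"
  "hadamard $$ (Suc 0, 0) = complex_of_real (1 / sqrt 2)"
  "hadamard $$ (Suc 0, Suc 0) = - complex_of_real (1 / sqrt 2)"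
  by (simp_all add: hadamard_def mat_of_rows_list_def)

lemma half_sqrt_2: "complex_of_real (1 / sqrt 2) * complex_of_real (1 / sqrt 2) = 1 / 2"
  unfolding of_real_mult[symmetric] by simp

lemma hadamard_mult_self [simp]: "hadamard * hadamard = 1\<^sub>m 2"
  by (rule eq_mat_2I) (simp_all add: mult_mat_index_2 half_sqrt_2 del: index_mult_mat of_real_divide)

definition hadamards :: "nat \<Rightarrow> nat list \<Rightarrow> complex mat" where
  "hadamards n qs = mat_prod_list (2 ^ n) (map (\<lambda>i. on_qubits n [i] hadamard) qs)"

lemma hadamards_Nil [simp]: "hadamards n [] = 1\<^sub>m (2 ^ n)"
  and hadamards_Cons [simp]: "hadamards n (q # qs) = on_qubits n [q] hadamard * hadamards n qs"
  by (simp_all add: hadamards_def)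

lemma hadamards_carrier [simp]: "hadamards n qs \<in> carrier_mat (2 ^ n) (2 ^ n)"
  by (induction qs) auto

abbreviation had_if :: "bool \<Rightarrow> complex mat" where
  "had_if b \<equiv> if b then hadamard else 1\<^sub>m 2"

text \<open>Associativity of matrix products is conditional on dimensions. Products are therefore
  kept nested to the right, and this rule and the next two rewrite at the head of such a
  product.\<close>

lemma mult_cancel_mat:
  fixes A :: "complex mat"
  assumes "A \<in> carrier_mat d d" "B \<in> carrier_mat d d" "C \<in> carrier_mat d d" "A * B = 1\<^sub>m d"
  shows "A * (B * C) = C"
  using square_mult_assoc[OF assms(1-3)] assms by simp

lemma mult_swap_mat:
  fixes A :: "complex mat"
  assumes "A \<in> carrier_mat d d" "B \<in> carrier_mat d d" "B' \<in> carrier_mat d d" "C \<in> carrier_mat d d"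
    and "A' \<in> carrier_mat d d" "A * B = B' * A'"
  shows "A * (B * C) = B' * (A' * C)"
  using square_mult_assoc[OF assms(1,2,4)] square_mult_assoc[OF assms(3,5,4)] assms(6) by simp

lemma intertwine_mult:
  fixes A :: "complex mat"
  assumes "P \<in> carrier_mat d d" "Q \<in> carrier_mat d d" "A \<in> carrier_mat d d"
    "B \<in> carrier_mat d d" "C \<in> carrier_mat d d" "P * B = C * P" "Q * A = B * Q"
  shows "(P * Q) * A = C * (P * Q)"
  using assms mult_swap_mat[of P d B C Q P] by (simp add: square_mult_assoc[of _ d])

text \<open>Intertwining relations compose factor by factor without mention of inverses. Hadamard
  gates on other qubits commute with the operator, and since the list is distinct, the one on qubit
  \<open>i\<close> conjugates it at most once.\<close>

lemma hadamards_on_qubit: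
  assumes "set qs \<subseteq> {1..n}" "distinct qs" "i \<in> {1..n}" and A: "A \<in> carrier_mat 2 2"
  shows "hadamards n qs * on_qubits n [i] A =
    on_qubits n [i] (had_if (i \<in> set qs) * A * had_if (i \<in> set qs)) * hadamards n qs"
  using assms(1,2)
proof (induction qs)
  case Nil
  then show ?case using A by simp
next
  case (Cons q qs)
  let ?A = "had_if (i \<in> set qs) * A * had_if (i \<in> set qs)"
  let ?B = "had_if (i \<in> set (q # qs)) * A * had_if (i \<in> set (q # qs))"
  have "on_qubits n [q] hadamard * on_qubits n [i] ?A = on_qubits n [i] ?B * on_qubits n [q] hadamard"
  proof (cases "q = i")
    case True
    then have "i \<notin> set qs" using Cons.prems by auto
    then show ?thesis using A assms(3) True
      by (simp add: on_qubits_mult_1 square_mult_assoc[of _ 2])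
  next
    case False
    then have "had_if (i \<in> set (q # qs)) = had_if (i \<in> set qs)" by auto
    moreover have "on_qubits n [q] hadamard * on_qubits n [i] ?A = on_qubits n [i] ?A * on_qubits n [q] hadamard"
      by (rule on_qubits_commute) (use False assms Cons.prems in auto)
    ultimately show ?thesis by simp
  qed
  moreover have "hadamards n qs * on_qubits n [i] A = on_qubits n [i] ?A * hadamards n qs"
    using Cons by simp
  ultimately show ?case
    unfolding hadamards_Cons
    by (intro intertwine_mult[where B = "on_qubits n [i] ?A" and d = "2 ^ n"]) simp_all
qed

lemma hadamards_commute_hadamard:
  assumes "set qs \<subseteq> {1..n}" "distinct qs" "i \<in> {1..n}"
  shows "hadamards n qs * on_qubits n [i] hadamard = on_qubits n [i] hadamard * hadamards n qs"
  using hadamards_on_qubit[OF assms, of hadamard]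
  by (simp add: left_mult_one_mat[of _ 2 2] right_mult_one_mat[of _ 2 2] split: if_splits)

lemma hadamards_square:
  assumes "set qs \<subseteq> {1..n}" "distinct qs"
  shows "hadamards n qs * hadamards n qs = 1\<^sub>m (2 ^ n)"
  using assms
proof (induction qs)
  case (Cons q qs)
  let ?H = "on_qubits n [q] hadamard"
  have "?H * hadamards n qs * (?H * hadamards n qs) = ?H * (hadamards n qs * (?H * hadamards n qs))"
    by (rule square_mult_assoc[where d = "2 ^ n"]) simp_all
  also have "hadamards n qs * (?H * hadamards n qs) = ?H * (hadamards n qs * hadamards n qs)"
    by (rule mult_swap_mat[where d = "2 ^ n"]) (use Cons.prems in \<open>simp_all add: hadamards_commute_hadamard\<close>)
  also have "?H * (?H * (hadamards n qs * hadamards n qs)) = hadamards n qs * hadamards n qs"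
    by (rule mult_cancel_mat[where d = "2 ^ n"])
       (use Cons.prems in \<open>simp_all add: on_qubits_mult_1 on_qubits_one_1\<close>)
  finally show ?case using Cons by simp
qed simp

lemma hadamards_on_pair:
  assumes "set qs \<subseteq> {1..n}" "distinct qs" "i \<in> {1..n}" "j \<in> {1..n}" "i \<noteq> j"
    and A: "A \<in> carrier_mat 4 4"
  defines "K \<equiv> \<lambda>qs. kron2 (had_if (i \<in> set qs)) (had_if (j \<in> set qs))"
  shows "hadamards n qs * on_qubits n [i, j] A = on_qubits n [i, j] (K qs * A * K qs) * hadamards n qs"
  using assms(1,2)
proof (induction qs)
  case Nil
  then show ?case using A by (simp add: K_def kron2_one)
next
  case (Cons q qs)
  have K: "K qs \<in> carrier_mat 4 4" for qs by (simp add: K_def)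
  have "on_qubits n [q] hadamard * on_qubits n [i, j] (K qs * A * K qs) =
    on_qubits n [i, j] (K (q # qs) * A * K (q # qs)) * on_qubits n [q] hadamard"
  proof (cases "q \<in> {i, j}")
    case True
    \<comment> \<open>This is the head Hadamard gate seen on the pair. By distinctness the
      corresponding factor of \<open>K qs\<close> is still trivial, so \<open>h\<close> completes
      \<open>K qs\<close> to \<open>K (q # qs)\<close>.\<close>
    define h where "h = kron2 (had_if (q = i)) (had_if (q = j))"
    have h: "h \<in> carrier_mat 4 4" by (simp add: h_def)
    have q: "on_qubits n [q] hadamard = on_qubits n [i, j] h"
      using True assms(3-5) on_qubits_first[of i n j hadamard] on_qubits_second[of i n j hadamard]
      by (auto simp: h_def)
    have hK: "h * K qs = K (q # qs)" "K (q # qs) * h = K qs"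
      using True assms(5) Cons.prems by (auto simp: K_def h_def kron2_mult)
    have "h * (K qs * A * K qs) = (K (q # qs) * A * K (q # qs)) * h"
      using hK h K A by (simp add: square_mult_assoc[of _ 4] mult_cancel_mat flip: hK(1))
    then show ?thesis using assms(3-5) A K h by (simp add: q on_qubits_mult_2)
  next
    case False
    then have "K (q # qs) = K qs" by (auto simp: K_def)
    moreover have "on_qubits n [q] hadamard * on_qubits n [i, j] B = on_qubits n [i, j] B * on_qubits n [q] hadamard" for B
      by (rule on_qubits_commute) (use False assms Cons.prems in auto)
    ultimately show ?thesis by simp
  qed
  moreover have "hadamards n qs * on_qubits n [i, j] A = on_qubits n [i, j] (K qs * A * K qs) * hadamards n qs"
    using Cons by simp
  ultimately show ?case
    unfolding hadamards_Cons
    by (intro intertwine_mult[where B = "on_qubits n [i, j] (K qs * A * K qs)" and d = "2 ^ n"]) simp_all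
qed

section \<open>Diagonal operators\<close>

lemma diagonal_mult_index:
  assumes "A \<in> carrier_mat d d" "diagonal_mat A" "B \<in> carrier_mat d d" "x < d" "y < d"
  shows "(A * B) $$ (x, y) = A $$ (x, x) * B $$ (x, y)"
proof -
  have "(A * B) $$ (x, y) = (\<Sum>z < d. A $$ (x, z) * B $$ (z, y))"
    using assms by (intro mult_mat_index) auto
  also have "\<dots> = (\<Sum>z \<in> {x}. A $$ (x, z) * B $$ (z, y))"
    using assms by (intro sum.mono_neutral_right) (auto simp: diagonal_mat_def)
  finally show ?thesis by simp
qed

lemma mult_diagonal_index:
  assumes "B \<in> carrier_mat d d" "diagonal_mat A" "A \<in> carrier_mat d d" "x < d" "y < d"
  shows "(B * A) $$ (x, y) = B $$ (x, y) * A $$ (y, y)"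
proof -
  have "(B * A) $$ (x, y) = (\<Sum>z < d. B $$ (x, z) * A $$ (z, y))"
    using assms by (intro mult_mat_index) auto
  also have "\<dots> = (\<Sum>z \<in> {y}. B $$ (x, z) * A $$ (z, y))"
    using assms by (intro sum.mono_neutral_right) (auto simp: diagonal_mat_def)
  finally show ?thesis by simp
qed

lemma diagonal_mult:
  assumes "A \<in> carrier_mat d d" "diagonal_mat A" "B \<in> carrier_mat d d" "diagonal_mat B"
  shows "diagonal_mat (A * B)"
  using assms diagonal_mult_index[OF assms(1,2,3)]
  by (auto simp: diagonal_mat_def simp del: index_mult_mat(1))

lemma diagonal_commute:
  fixes A :: "complex mat"
  assumes "A \<in> carrier_mat d d" "diagonal_mat A" "B \<in> carrier_mat d d" "diagonal_mat B"
  shows "A * B = B * A"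
proof (rule eq_matI)
  fix x y assume "x < dim_row (B * A)" "y < dim_col (B * A)"
  then have *: "x < d" "y < d" using assms by auto
  have "A $$ (x, x) * B $$ (x, y) = B $$ (x, x) * A $$ (x, y)"
    using * assms by (cases "x = y") (auto simp: diagonal_mat_def mult.commute)
  then show "(A * B) $$ (x, y) = (B * A) $$ (x, y)"
    using * assms diagonal_mult_index[of A d B x y] diagonal_mult_index[of B d A x y] by simp
qed (use assms in auto)

text \<open>Two different indices that agree off \<open>qs\<close> have different values of
  \<open>sub_index\<close>, so they select an off-diagonal entry of \<open>U\<close>.\<close>

lemma on_qubits_diagonal:
  assumes "U \<in> carrier_mat (2 ^ length qs) (2 ^ length qs)" "diagonal_mat U"
  shows "diagonal_mat (on_qubits n qs U)"
  unfolding diagonal_mat_def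
proof (intro allI impI)
  fix x y assume "x < dim_row (on_qubits n qs U)" "y < dim_col (on_qubits n qs U)" and ne: "x \<noteq> y"
  then have x: "x < 2 ^ n" and y: "y < 2 ^ n" by auto
  show "on_qubits n qs U $$ (x, y) = 0"
  proof (cases "\<forall>q \<in> {1..n} - set qs. qubit_val n x q = qubit_val n y q")
    case True
    then have "sub_index n qs x \<noteq> sub_index n qs y" using qubit_index_eqI_on[OF x y True] ne by blast
    then show ?thesis unfolding on_qubits_index_agree[OF x y True]
      using assms sub_index_less[of n qs] by (auto simp: diagonal_mat_def)
  qed (rule on_qubits_index_eq_0[OF x y])
qed

lemma mat_prod_list_diagonal:
  assumes "\<And>M. M \<in> set Ms \<Longrightarrow> M \<in> carrier_mat d d \<and> diagonal_mat M"
  shows "diagonal_mat (mat_prod_list d Ms)"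
  using assms
proof (induction Ms)
  case Nil
  show ?case by (simp add: diagonal_mat_def)
next
  case (Cons M Ms)
  then show ?case by (auto intro!: diagonal_mult[where d = d])
qed

text \<open>Diagonal factors commute, so the square of the product is the product of the squares.
  This makes each controlled-Z layer its own inverse.\<close>

lemma mat_prod_list_diagonal_square:
  fixes Ms :: "complex mat list"
  assumes "\<And>M. M \<in> set Ms \<Longrightarrow> M \<in> carrier_mat d d \<and> diagonal_mat M \<and> M * M = 1\<^sub>m d"
  shows "mat_prod_list d Ms * mat_prod_list d Ms = 1\<^sub>m d"
  using assms
proof (induction Ms)
  case (Cons M Ms)
  let ?P = "mat_prod_list d Ms"
  have M: "M \<in> carrier_mat d d" "diagonal_mat M" "M * M = 1\<^sub>m d" using Cons.prems by auto
  have P: "?P \<in> carrier_mat d d" "diagonal_mat ?P"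
    using Cons.prems by (auto intro!: mat_prod_list_diagonal)
  have "M * ?P * (M * ?P) = M * (?P * (M * ?P))" by (rule square_mult_assoc[where d = d]) (use M P in simp_all)
  also have "?P * (M * ?P) = M * (?P * ?P)"
    by (rule mult_swap_mat[where d = d]) (use M P diagonal_commute[of ?P d M] in simp_all)
  also have "M * (M * (?P * ?P)) = ?P * ?P" by (rule mult_cancel_mat[where d = d]) (use M P in simp_all)
  finally show ?case using Cons by simp
qed simp

subsection \<open>The period of the circuit without rotations\<close>

unbundle bit_operations_syntax

definition perm_mat :: "nat \<Rightarrow> (nat \<Rightarrow> nat) \<Rightarrow> complex mat" where
  "perm_mat n f = mat (2 ^ n) (2 ^ n) (\<lambda>(x, y). of_bool (x = f y))"

lemma perm_mat_carrier [simp]: "perm_mat n f \<in> carrier_mat (2 ^ n) (2 ^ n)"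
  by (simp add: perm_mat_def)

lemma perm_mat_mult:
  assumes "\<And>y. y < 2 ^ n \<Longrightarrow> g y < 2 ^ n"
  shows "perm_mat n f * perm_mat n g = perm_mat n (f \<circ> g)"
proof (rule eq_matI)
  fix x y assume "x < dim_row (perm_mat n (f \<circ> g))" "y < dim_col (perm_mat n (f \<circ> g))"
  then have x: "x < 2 ^ n" and y: "y < 2 ^ n" by (auto simp: perm_mat_def)
  have "(perm_mat n f * perm_mat n g) $$ (x, y) = (\<Sum>z < 2 ^ n. perm_mat n f $$ (x, z) * perm_mat n g $$ (z, y))"
    by (rule mult_mat_index) (use x y in auto)
  also have "\<dots> = (\<Sum>z \<in> {g y}. perm_mat n f $$ (x, z) * perm_mat n g $$ (z, y))"
    by (rule sum.mono_neutral_right) (use x y assms in \<open>auto simp: perm_mat_def\<close>)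
  also have "\<dots> = perm_mat n (f \<circ> g) $$ (x, y)"
    using x y assms by (simp add: perm_mat_def)
  finally show "(perm_mat n f * perm_mat n g) $$ (x, y) = perm_mat n (f \<circ> g) $$ (x, y)" .
qed (auto simp: perm_mat_def)

lemma perm_mat_eq_one:
  assumes "\<And>y. y < 2 ^ n \<Longrightarrow> f y = y"
  shows "perm_mat n f = 1\<^sub>m (2 ^ n)"
  using assms by (intro eq_matI) (auto simp: perm_mat_def)

text \<open>Basis indices serve as vectors over the two-element field, with XOR as addition. The
  last clause says that \<open>f\<close> minus the identity strictly raises the 2-adic valuation;
  that is strict triangularity with respect to the flag of multiples of \<open>2 ^ m\<close>,
  expressed without matrices over that field.\<close>

definition unitriangular :: "nat \<Rightarrow> (nat \<Rightarrow> nat) \<Rightarrow> bool" where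
  "unitriangular n f \<longleftrightarrow> (\<forall>x < 2 ^ n. f x < 2 ^ n) \<and> (\<forall>x y :: nat. f (x XOR y) = f x XOR f y) \<and>
     (\<forall>x m. 2 ^ m dvd x \<longrightarrow> 2 ^ Suc m dvd (f x XOR x))"

lemma power2_dvd_xor:
  "2 ^ m dvd (x :: nat) \<Longrightarrow> 2 ^ m dvd y \<Longrightarrow> 2 ^ m dvd (x XOR y)"
  by (simp flip: take_bit_eq_0_iff)

lemma unitriangular_dvd: "unitriangular n f \<Longrightarrow> 2 ^ m dvd x \<Longrightarrow> 2 ^ m dvd f x"
proof -
  assume f: "unitriangular n f" and x: "2 ^ m dvd x"
  then have "2 ^ Suc m dvd (f x XOR x)" unfolding unitriangular_def by blast
  then have "2 ^ m dvd (f x XOR x)" by (rule power_le_dvd) simp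
  then have "2 ^ m dvd ((f x XOR x) XOR x)" using x by (rule power2_dvd_xor)
  then show ?thesis by (simp add: xor.assoc)
qed

lemma unitriangular_id: "unitriangular n id"
  by (simp add: unitriangular_def)

text \<open>Over the two-element field \<open>f g + 1 = (f + 1) g + (g + 1)\<close>, and
  \<open>g\<close> preserves divisibility by \<open>2 ^ m\<close>.\<close>

lemma unitriangular_comp:
  assumes f: "unitriangular n f" and g: "unitriangular n g"
  shows "unitriangular n (f \<circ> g)"
proof -
  have "2 ^ Suc m dvd (f (g x) XOR x)" if "2 ^ m dvd x" for m x
  proof -
    have "2 ^ Suc m dvd (f (g x) XOR g x)"
      using f unitriangular_dvd[OF g that] unfolding unitriangular_def by blast
    moreover have "2 ^ Suc m dvd (g x XOR x)" using g that unfolding unitriangular_def by blast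
    ultimately have "2 ^ Suc m dvd ((f (g x) XOR g x) XOR (g x XOR x))" by (rule power2_dvd_xor)
    also have "(f (g x) XOR g x) XOR (g x XOR x) = f (g x) XOR x"
      by (simp add: xor.assoc) (simp flip: xor.assoc)
    finally show ?thesis .
  qed
  then show ?thesis using f g by (auto simp: unitriangular_def)
qed

lemma unitriangular_funpow: "unitriangular n f \<Longrightarrow> unitriangular n (f ^^ m)"
  by (induction m) (simp_all add: unitriangular_id unitriangular_comp)

text \<open>With \<open>N = f + 1\<close> over the two-element field, \<open>f\<^sup>2 + 1 = N\<^sup>2\<close>.\<close>

lemma unitriangular_funpow_dvd:
  assumes "unitriangular n f" "2 ^ m dvd x"
  shows "2 ^ (m + 2 ^ k) dvd ((f ^^ (2 ^ k)) x XOR x)"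
  using assms(2)
proof (induction k arbitrary: m x)
  case 0
  then show ?case using assms(1) by (simp add: unitriangular_def)
next
  case (Suc k)
  let ?g = "f ^^ (2 ^ k)"
  have lin: "?g (x XOR y) = ?g x XOR ?g y" for x y
    using unitriangular_funpow[OF assms(1)] unfolding unitriangular_def by blast
  \<comment> \<open>The hypothesis is used at \<open>x\<close> and again at
    \<open>?g x XOR x\<close>, whose valuation has already grown by \<open>2 ^ k\<close>.\<close>
  have "2 ^ (m + 2 ^ k + 2 ^ k) dvd (?g (?g x XOR x) XOR (?g x XOR x))"
    by (rule Suc.IH, rule Suc.IH, rule Suc.prems)
  also have "?g (?g x XOR x) XOR (?g x XOR x) = ?g (?g x) XOR x"
    unfolding lin by (simp add: xor.assoc) (simp flip: xor.assoc)
  also have "?g (?g x) = (f ^^ (2 ^ Suc k)) x" by (simp add: mult_2 funpow_add)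
  finally show ?case by (simp add: mult_2 add.assoc)
qed

text \<open>Once \<open>2 ^ k\<close> reaches \<open>n\<close>, the difference from the identity is
  divisible by \<open>2 ^ n\<close>, while both numbers have at most \<open>n\<close> binary
  digits.\<close>

lemma unitriangular_funpow_id:
  assumes "unitriangular n f" "n \<le> 2 ^ k" "x < 2 ^ n"
  shows "(f ^^ (2 ^ k)) x = x"
proof -
  let ?y = "(f ^^ (2 ^ k)) x"
  have "2 ^ (0 + 2 ^ k) dvd (?y XOR x)" by (rule unitriangular_funpow_dvd[OF assms(1)]) simp
  then have "2 ^ n dvd (?y XOR x)" by (rule power_le_dvd) (use assms in simp)
  moreover have "?y < 2 ^ n" using unitriangular_funpow[OF assms(1), of "2 ^ k"] assms(3)
    unfolding unitriangular_def by blast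
  ultimately have "take_bit n ?y XOR take_bit n x = 0"
    by (simp flip: take_bit_eq_0_iff add: take_bit_xor)
  then have "?y XOR x = 0" using \<open>?y < 2 ^ n\<close> assms(3) by (simp add: take_bit_nat_eq_self)
  then have "(?y XOR x) XOR x = x" by simp
  then show ?thesis by (simp add: xor.assoc)
qed

text \<open>The control is the second qubit and the target the first, so a bit is added to the next
  more significant one.\<close>

definition cnot_up :: "complex mat" where
  "cnot_up = mat 4 4 (\<lambda>(r, c). of_bool ((r, c) \<in> {(0, 0), (3, 1), (2, 2), (1, 3)}))"

definition cnot_up_map :: "nat \<Rightarrow> nat \<Rightarrow> nat \<Rightarrow> nat" where
  "cnot_up_map n j x = x XOR (if bit x (n - Suc j) then 2 ^ (n - j) else 0)"

text \<open>The only bit that can change lies directly above a set bit, and the set bits of a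
  multiple of \<open>2 ^ m\<close> have positions at least \<open>m\<close>.\<close>

lemma cnot_up_map_unitriangular:
  assumes "1 \<le> j" "j < n"
  shows "unitriangular n (cnot_up_map n j)"
proof -
  have nj: "n - j = Suc (n - Suc j)" using assms by simp
  have "cnot_up_map n j x < 2 ^ n" if "x < 2 ^ n" for x
  proof -
    have "take_bit n (cnot_up_map n j x) = cnot_up_map n j x"
      using that assms by (simp add: cnot_up_map_def take_bit_xor take_bit_nat_eq_self)
    then show ?thesis by (simp add: take_bit_nat_eq_self_iff)
  qed
  moreover have "cnot_up_map n j (x XOR y) = cnot_up_map n j x XOR cnot_up_map n j y" for x y
    by (rule bit_eqI) (auto simp: cnot_up_map_def bit_xor_iff)
  moreover have "2 ^ Suc m dvd (cnot_up_map n j x XOR x)" if "2 ^ m dvd x" for m x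
  proof -
    have eq: "cnot_up_map n j x XOR x = (if bit x (n - Suc j) then 2 ^ (n - j) else 0)"
      unfolding cnot_up_map_def by (subst xor.commute) (simp flip: xor.assoc)
    have "m \<le> n - Suc j" if "bit x (n - Suc j)"
    proof (rule ccontr)
      assume "\<not> m \<le> n - Suc j"
      then have "bit (take_bit m x) (n - Suc j)" using that by (simp add: bit_take_bit_iff)
      moreover have "take_bit m x = 0" using \<open>2 ^ m dvd x\<close> by (simp add: take_bit_eq_0_iff)
      ultimately show False by simp
    qed
    then show ?thesis unfolding eq nj by (auto intro!: le_imp_power_dvd simp del: power_Suc)
  qed
  ultimately show ?thesis unfolding unitriangular_def by blast
qed

lemma qubit_val_cnot_up_map:
  assumes "1 \<le> j" "j < n" "q \<in> {1..n}"
  shows "qubit_val n (cnot_up_map n j x) q =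
    (if q = j \<and> bit x (n - Suc j) then 1 - qubit_val n x q else qubit_val n x q)"
proof -
  have "n - q = n - j \<longleftrightarrow> q = j" using assms by auto
  then show ?thesis
    by (auto simp: qubit_val_def cnot_up_map_def bit_xor_iff bit_exp_iff of_bool_eq_iff)
qed

lemma on_qubits_cnot_up:
  assumes j: "1 \<le> j" "j < n"
  shows "on_qubits n [j, Suc j] cnot_up = perm_mat n (cnot_up_map n j)"
proof (rule eq_matI)
  fix x y assume "x < dim_row (perm_mat n (cnot_up_map n j))" "y < dim_col (perm_mat n (cnot_up_map n j))"
  then have x: "x < 2 ^ n" and y: "y < 2 ^ n" by (auto simp: perm_mat_def)
  let ?f = "cnot_up_map n j"
  have fy: "?f y < 2 ^ n" using cnot_up_map_unitriangular[OF j] y by (simp add: unitriangular_def)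
  have c: "cnot_up $$ (sub_index n [j, Suc j] x, sub_index n [j, Suc j] y) =
    of_bool (qubit_val n x j = qubit_val n (?f y) j \<and> qubit_val n x (Suc j) = qubit_val n (?f y) (Suc j))"
  proof -
    have "qubit_val n (?f y) j = of_bool (bit y (n - j) \<noteq> bit y (n - Suc j))"
      "qubit_val n (?f y) (Suc j) = qubit_val n y (Suc j)"
      using j by (auto simp: qubit_val_cnot_up_map) (auto simp: qubit_val_def)
    then show ?thesis unfolding sub_index_2
      by (simp only:) (auto simp: cnot_up_def qubit_val_def)
  qed
  show "on_qubits n [j, Suc j] cnot_up $$ (x, y) = perm_mat n ?f $$ (x, y)"
  proof (cases "\<forall>q \<in> {1..n} - set [j, Suc j]. qubit_val n x q = qubit_val n y q")
    case True
    have eq: "x = ?f y" if "qubit_val n x j = qubit_val n (?f y) j" "qubit_val n x (Suc j) = qubit_val n (?f y) (Suc j)"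
    proof (rule qubit_index_eqI[OF x fy])
      fix q assume q: "q \<in> {1..n}"
      show "qubit_val n x q = qubit_val n (?f y) q"
      proof (cases "q \<in> {j, Suc j}")
        case False
        then have "qubit_val n x q = qubit_val n y q" using True q by auto
        then show ?thesis using False j q by (simp add: qubit_val_cnot_up_map)
      qed (use that in auto)
    qed
    show ?thesis unfolding on_qubits_index_agree[OF x y True] c
      using x y by (auto simp: perm_mat_def dest: eq)
  next
    case False
    then obtain q where "q \<in> {1..n} - set [j, Suc j]" "qubit_val n x q \<noteq> qubit_val n y q"
      by blast
    then have "x \<noteq> ?f y" using j qubit_val_cnot_up_map[of j n q y] by auto
    then show ?thesis unfolding on_qubits_index_eq_0[OF x y False]
      using x y by (simp add: perm_mat_def)
  qed
qed (auto simp: perm_mat_def)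

section \<open>Controlled-Z layers as products of CNOT gates\<close>

lemma controlled_z_carrier [simp]: "controlled_z \<in> carrier_mat 4 4"
  by (auto simp: controlled_z_def mat_of_rows_list_def)

lemma controlled_z_index:
  "r < 4 \<Longrightarrow> c < 4 \<Longrightarrow> controlled_z $$ (r, c) = (if r = c then if r = 3 then - 1 else 1 else 0)"
  by (auto simp: controlled_z_def mat_of_rows_list_def less_4_cases)

lemma controlled_z_diagonal: "diagonal_mat controlled_z"
  by (use carrier_matD[OF controlled_z_carrier] in \<open>auto simp: diagonal_mat_def controlled_z_index\<close>)

lemma hadamard_controlled_z:
  "kron2 hadamard (1\<^sub>m 2) * controlled_z * kron2 hadamard (1\<^sub>m 2) = cnot_up"
  by (rule eq_mat_4I)
     (auto simp: mult_mat_index_4 kron2_index controlled_z_index cnot_up_def half_sqrt_2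
       simp del: index_mult_mat of_real_divide)

text \<open>This is the case of a pair whose second qubit is even: on it, the gates from the full
  Hadamard layer and from the even qubits cancel, and only the first qubit keeps its Hadamard gate
  and becomes the target.\<close>

lemma hadamard_controlled_z_2:
  "kron2 (1\<^sub>m 2) hadamard * (kron2 hadamard hadamard * controlled_z * kron2 hadamard hadamard)
     * kron2 (1\<^sub>m 2) hadamard = cnot_up"
proof -
  let ?a = "kron2 (1\<^sub>m 2) hadamard" and ?b = "kron2 hadamard hadamard" and ?c = "kron2 hadamard (1\<^sub>m 2)"
  have "?b = ?a * ?c" "?b = ?c * ?a" by (simp_all add: kron2_mult)
  moreover have "?a * ?a = 1\<^sub>m 4" by (simp add: kron2_mult kron2_one)
  ultimately have "?a * (?b * controlled_z * ?b) * ?a = ?c * controlled_z * ?c"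
    by (simp add: square_mult_assoc[of _ 4] mult_cancel_mat[of _ 4])
  then show ?thesis by (simp add: hadamard_controlled_z)
qed

lemma h_layer_eq: "h_layer n = hadamards n [1..<n + 1]"
  by (simp add: h_layer_def hadamards_def)

lemma layer_carrier [simp]:
  "h_layer n \<in> carrier_mat (2 ^ n) (2 ^ n)" "rz_layer n \<beta> \<in> carrier_mat (2 ^ n) (2 ^ n)"
  "cz_e_layer n \<in> carrier_mat (2 ^ n) (2 ^ n)" "cz_o_layer n \<in> carrier_mat (2 ^ n) (2 ^ n)"
  "cz_layer n t \<in> carrier_mat (2 ^ n) (2 ^ n)"
proof -
  show 1: "cz_e_layer n \<in> carrier_mat (2 ^ n) (2 ^ n)" "cz_o_layer n \<in> carrier_mat (2 ^ n) (2 ^ n)"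
    unfolding cz_e_layer_def cz_o_layer_def by (rule mat_prod_list_carrier, auto)+
  show "h_layer n \<in> carrier_mat (2 ^ n) (2 ^ n)" "rz_layer n \<beta> \<in> carrier_mat (2 ^ n) (2 ^ n)"
    unfolding h_layer_def rz_layer_def by (rule mat_prod_list_carrier, auto)+
  show "cz_layer n t \<in> carrier_mat (2 ^ n) (2 ^ n)" using 1 by (simp add: cz_layer_def)
qed

lemma h_layer_square [simp]: "h_layer n * h_layer n = 1\<^sub>m (2 ^ n)"
  unfolding h_layer_eq by (rule hadamards_square) auto

text \<open>The period depends only on the class of the permutation, so an existential
  \<open>f\<close> is enough; the class is closed under composition.\<close>

lemma prod_perm_intertwine:
  assumes P: "P \<in> carrier_mat (2 ^ n) (2 ^ n)"
    and "\<And>M. M \<in> set Ms \<Longrightarrow> M \<in> carrier_mat (2 ^ n) (2 ^ n) \<and> (\<exists>f. unitriangular n f \<and> P * M = perm_mat n f * P)"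
  shows "\<exists>f. unitriangular n f \<and> P * mat_prod_list (2 ^ n) Ms = perm_mat n f * P"
  using assms(2)
proof (induction Ms)
  case Nil
  have "perm_mat n id = 1\<^sub>m (2 ^ n)" by (rule perm_mat_eq_one) simp
  then show ?case using P unitriangular_id[of n] by (intro exI[of _ id]) (simp del: id_apply)
next
  case (Cons M Ms)
  obtain f where f: "unitriangular n f" "P * M = perm_mat n f * P" and M: "M \<in> carrier_mat (2 ^ n) (2 ^ n)"
    using Cons.prems by auto
  obtain g where g: "unitriangular n g" "P * mat_prod_list (2 ^ n) Ms = perm_mat n g * P"
    using Cons by auto
  have C: "mat_prod_list (2 ^ n) Ms \<in> carrier_mat (2 ^ n) (2 ^ n)" using Cons.prems by simp
  have "P * (M * mat_prod_list (2 ^ n) Ms) = perm_mat n f * (P * mat_prod_list (2 ^ n) Ms)"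
    by (rule mult_swap_mat[where d = "2 ^ n"]) (use P M C f in simp_all)
  also have "\<dots> = perm_mat n f * perm_mat n g * P"
    using P g by (simp add: square_mult_assoc[of _ "2 ^ n"])
  also have "perm_mat n f * perm_mat n g = perm_mat n (f \<circ> g)"
    by (rule perm_mat_mult) (use g in \<open>simp add: unitriangular_def\<close>)
  finally show ?case using unitriangular_comp[OF f(1) g(1)] by auto
qed

text \<open>
  Conjugated by the Hadamard gates on the even qubits, two rounds with vanishing angles become a
  product of CNOT gates, each of which adds a bit to the next more significant one.
\<close>

definition double_round :: "nat \<Rightarrow> complex mat" where
  "double_round n = cz_o_layer n * (h_layer n * (cz_e_layer n * h_layer n))"

lemma double_round_carrier [simp]: "double_round n \<in> carrier_mat (2 ^ n) (2 ^ n)"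
  by (simp add: double_round_def)

definition even_hadamards :: "nat \<Rightarrow> complex mat" where
  "even_hadamards n = hadamards n (filter even [1..<n + 1])"

lemma even_hadamards_carrier [simp]: "even_hadamards n \<in> carrier_mat (2 ^ n) (2 ^ n)"
  by (simp only: even_hadamards_def hadamards_carrier)

lemma even_hadamards_square: "even_hadamards n * even_hadamards n = 1\<^sub>m (2 ^ n)"
  unfolding even_hadamards_def by (rule hadamards_square) auto

lemma even_hadamards_on_pair:
  assumes "1 \<le> j" "j < n" "A \<in> carrier_mat 4 4"
  defines "K \<equiv> kron2 (had_if (even j)) (had_if (odd j))"
  shows "even_hadamards n * on_qubits n [j, Suc j] A = on_qubits n [j, Suc j] (K * A * K) * even_hadamards n"
proof -
  have "j \<in> set (filter even [1..<n + 1]) \<longleftrightarrow> even j" "Suc j \<in> set (filter even [1..<n + 1]) \<longleftrightarrow> odd j"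
    using assms(1,2) by (auto simp del: upt_Suc)
  moreover have "set (filter even [1..<n + 1]) \<subseteq> {1..n}" by auto
  ultimately show ?thesis
    using hadamards_on_pair[of "filter even [1..<n + 1]" n j "Suc j" A] assms(1-3)
    unfolding K_def even_hadamards_def by (simp del: upt_Suc)
qed

lemma h_layer_on_pair:
  assumes "1 \<le> j" "j < n" "A \<in> carrier_mat 4 4"
  defines "K \<equiv> kron2 hadamard hadamard"
  shows "h_layer n * on_qubits n [j, Suc j] A = on_qubits n [j, Suc j] (K * A * K) * h_layer n"
  using hadamards_on_pair[of "[1..<n + 1]" n j "Suc j" A] assms(1-3)
  unfolding K_def h_layer_eq by (simp add: atLeastLessThanSuc_atLeastAtMost del: upt_Suc)

lemma even_hadamards_cz_o_layer:
  "\<exists>f. unitriangular n f \<and> even_hadamards n * cz_o_layer n = perm_mat n f * even_hadamards n"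
  unfolding cz_o_layer_def
proof (rule prod_perm_intertwine)
  fix M assume "M \<in> set (map (\<lambda>k. on_qubits n [2 * k, 2 * k + 1] controlled_z) [1..<n div 2])"
  then obtain k where k: "1 \<le> k" "k < n div 2" "M = on_qubits n [2 * k, Suc (2 * k)] controlled_z" by auto
  then have j: "1 \<le> 2 * k" "2 * k < n" by auto
  have "even_hadamards n * M = on_qubits n [2 * k, Suc (2 * k)] cnot_up * even_hadamards n"
    using even_hadamards_on_pair[OF j controlled_z_carrier] by (simp add: k(3) hadamard_controlled_z)
  then show "M \<in> carrier_mat (2 ^ n) (2 ^ n) \<and>
      (\<exists>f. unitriangular n f \<and> even_hadamards n * M = perm_mat n f * even_hadamards n)"
    using k(3) on_qubits_cnot_up[OF j] cnot_up_map_unitriangular[OF j] by auto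
qed simp

lemma even_hadamards_cz_e_layer:
  "\<exists>f. unitriangular n f \<and>
     even_hadamards n * h_layer n * cz_e_layer n = perm_mat n f * (even_hadamards n * h_layer n)"
  unfolding cz_e_layer_def
proof (rule prod_perm_intertwine)
  fix M assume "M \<in> set (map (\<lambda>k. on_qubits n [2 * k - 1, 2 * k] controlled_z) [1..<n div 2 + 1])"
  then obtain k where k: "1 \<le> k" "k \<le> n div 2" "M = on_qubits n [2 * k - 1, 2 * k] controlled_z" by auto
  define j where "j = 2 * k - 1"
  have j: "1 \<le> j" "j < n" "odd j" "2 * k = Suc j" using k(1,2) by (auto simp: j_def)
  have M: "M = on_qubits n [j, Suc j] controlled_z" unfolding k(3) j(4)[symmetric] by (simp add: j_def)
  let ?HH = "kron2 hadamard hadamard"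
  have "h_layer n * M = on_qubits n [j, Suc j] (?HH * controlled_z * ?HH) * h_layer n"
    using h_layer_on_pair[OF j(1,2) controlled_z_carrier] by (simp add: M)
  moreover have "even_hadamards n * on_qubits n [j, Suc j] (?HH * controlled_z * ?HH) =
      on_qubits n [j, Suc j] cnot_up * even_hadamards n"
    using even_hadamards_on_pair[OF j(1,2), of "?HH * controlled_z * ?HH"] j(3)
    by (simp add: hadamard_controlled_z_2)
  ultimately have "even_hadamards n * h_layer n * M = on_qubits n [j, Suc j] cnot_up * (even_hadamards n * h_layer n)"
    by (intro intertwine_mult[where d = "2 ^ n"]) (simp_all add: M)
  then show "M \<in> carrier_mat (2 ^ n) (2 ^ n) \<and>
      (\<exists>f. unitriangular n f \<and> even_hadamards n * h_layer n * M = perm_mat n f * (even_hadamards n * h_layer n))"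
    using M on_qubits_cnot_up[OF j(1,2)] cnot_up_map_unitriangular[OF j(1,2)] by auto
qed simp

lemma even_hadamards_double_round:
  "\<exists>f. unitriangular n f \<and> even_hadamards n * double_round n = perm_mat n f * even_hadamards n"
proof -
  let ?W = "even_hadamards n" and ?h = "h_layer n"
  obtain f where f: "unitriangular n f" "?W * cz_o_layer n = perm_mat n f * ?W"
    using even_hadamards_cz_o_layer by blast
  obtain g where g: "unitriangular n g" "?W * ?h * cz_e_layer n = perm_mat n g * (?W * ?h)"
    using even_hadamards_cz_e_layer by blast
  have "?W * double_round n = perm_mat n f * (?W * (?h * (cz_e_layer n * ?h)))"
    unfolding double_round_def by (rule mult_swap_mat[where d = "2 ^ n"]) (simp_all add: f)
  \<comment> \<open>The layer \<open>cz_e_layer\<close> is intertwined by \<open>?W * ?h\<close>,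
    and the Hadamard layer carried along then cancels against the first one of the circuit.\<close>
  also have "?W * (?h * (cz_e_layer n * ?h)) = (?W * ?h * cz_e_layer n) * ?h"
    by (simp add: square_mult_assoc[of _ "2 ^ n"])
  also have "\<dots> = perm_mat n g * ?W"
    unfolding g by (simp add: square_mult_assoc[of _ "2 ^ n"])
  also have "perm_mat n f * (perm_mat n g * ?W) = perm_mat n f * perm_mat n g * ?W"
    by (simp add: square_mult_assoc[of _ "2 ^ n"])
  also have "perm_mat n f * perm_mat n g = perm_mat n (f \<circ> g)"
    by (rule perm_mat_mult) (use g in \<open>simp add: unitriangular_def\<close>)
  finally show ?thesis using unitriangular_comp[OF f(1) g(1)] by blast
qed

text \<open>The intertwining relation passes to powers, where the permutation becomes trivial; the
  intertwiner is an involution and can be cancelled.\<close>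

lemma double_round_power_one:
  assumes "n \<le> 2 ^ k"
  shows "double_round n ^\<^sub>m (2 ^ k) = 1\<^sub>m (2 ^ n)"
proof -
  let ?W = "even_hadamards n" and ?T = "double_round n"
  obtain f where f: "unitriangular n f" "?W * ?T = perm_mat n f * ?W"
    using even_hadamards_double_round by blast
  have T: "?T ^\<^sub>m m \<in> carrier_mat (2 ^ n) (2 ^ n)" for m by (rule pow_carrier_mat) simp
  have *: "?W * ?T ^\<^sub>m m = perm_mat n (f ^^ m) * ?W" for m
  proof (induction m)
    case 0
    have "perm_mat n (f ^^ 0) = 1\<^sub>m (2 ^ n)" by (rule perm_mat_eq_one) simp
    then show ?case by (simp add: carrier_matD[OF double_round_carrier] del: funpow_0 funpow.simps)
  next
    case (Suc m)
    have "?W * ?T ^\<^sub>m Suc m = perm_mat n (f ^^ m) * (?W * ?T)"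
      using mult_swap_mat[OF _ T _ _ _ Suc] by simp
    also have "\<dots> = perm_mat n (f ^^ m) * perm_mat n f * ?W"
      unfolding f by (simp add: square_mult_assoc[of _ "2 ^ n"])
    also have "perm_mat n (f ^^ m) * perm_mat n f = perm_mat n ((f ^^ m) \<circ> f)"
      by (rule perm_mat_mult) (use f in \<open>simp add: unitriangular_def\<close>)
    finally show ?case by (simp only: funpow_Suc_right)
  qed
  have W: "?W * ?W = 1\<^sub>m (2 ^ n)" by (rule even_hadamards_square)
  have "perm_mat n (f ^^ (2 ^ k)) = 1\<^sub>m (2 ^ n)"
    by (rule perm_mat_eq_one) (rule unitriangular_funpow_id[OF f(1) assms])
  then have "?W * ?T ^\<^sub>m (2 ^ k) = ?W" using *[of "2 ^ k"] by simp
  then have "?W * (?W * ?T ^\<^sub>m (2 ^ k)) = 1\<^sub>m (2 ^ n)" using W by simp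
  then show ?thesis using mult_cancel_mat[OF _ _ T W] by simp
qed

text \<open>The periods obtained are powers of two; choosing one in this range keeps the period
  linear in \<open>n\<close>.\<close>

lemma ex_power_2_between:
  assumes "0 < (n :: nat)"
  shows "\<exists>k. n \<le> 2 ^ k \<and> 2 ^ k \<le> 2 * n"
  using assms
proof (induction n rule: nat_induct_non_zero)
  case 1
  then show ?case by (intro exI[of _ 0]) simp
next
  case (Suc n)
  then obtain k where k: "n \<le> 2 ^ k" "2 ^ k \<le> 2 * n" by blast
  then show ?case
  proof (cases "n = 2 ^ k")
    case True
    then show ?thesis using Suc.hyps by (intro exI[of _ "Suc k"]) simp
  next
    case False
    then show ?thesis using k by (intro exI[of _ k]) simp
  qed
qed

subsection \<open>Reachable operators\<close>

lemma brickwork_carrier [simp]: "brickwork n \<alpha> L \<in> carrier_mat (2 ^ n) (2 ^ n)"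
  by (induction L) auto

lemma brickwork_cong:
  "(\<And>i t. 1 \<le> t \<Longrightarrow> t \<le> L \<Longrightarrow> \<alpha> i t = \<beta> i t) \<Longrightarrow> brickwork n \<alpha> L = brickwork n \<beta> L"
  by (induction L) simp_all

text \<open>The parity of the round number selects the controlled-Z layer, so only a shift by an
  even number of rounds gives a circuit of the family again.\<close>

lemma brickwork_add:
  assumes "even s"
  shows "brickwork n \<alpha> (s + t) = brickwork n (\<lambda>i u. \<alpha> i (s + u)) t * brickwork n \<alpha> s"
proof (induction t)
  case (Suc t)
  have "cz_layer n (Suc (s + t)) = cz_layer n (Suc t)" using assms by (simp add: cz_layer_def)
  then show ?case using Suc by (simp add: square_mult_assoc[of _ "2 ^ n"])
qed simp

text \<open>Even depth makes the notion closed under products. The depth is only bounded by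
  \<open>k\<close>, because two rounds with vanishing angles are in general not the identity and
  cannot serve as padding.\<close>

definition reachable :: "nat \<Rightarrow> nat \<Rightarrow> complex mat \<Rightarrow> bool" where
  "reachable n k U \<longleftrightarrow> U \<in> carrier_mat (2 ^ n) (2 ^ n) \<and>
     (\<exists>L \<alpha> \<phi>. even L \<and> L \<le> k \<and> brickwork n \<alpha> L = cis \<phi> \<cdot>\<^sub>m U)"

lemma smult_one_mat: "1 \<cdot>\<^sub>m (A :: complex mat) = A"
  by (rule eq_matI) auto

lemma smult_smult_mat: "a \<cdot>\<^sub>m (b \<cdot>\<^sub>m A) = (a * b :: complex) \<cdot>\<^sub>m A"
  by (rule eq_matI) auto

lemma reachable_one: "reachable n k (1\<^sub>m (2 ^ n))"
  unfolding reachable_def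
  by (intro conjI exI[of _ "0 :: nat"] exI[of _ undefined] exI[of _ "0 :: real"]) (auto simp: smult_one_mat)

lemma reachable_mono: "reachable n k U \<Longrightarrow> k \<le> l \<Longrightarrow> reachable n l U"
  unfolding reachable_def by (meson le_trans)

lemma reachable_mult:
  assumes "reachable n k U" "reachable n l V" "k + l \<le> m"
  shows "reachable n m (U * V)"
proof -
  from assms(1) obtain L \<alpha> \<phi> where U: "U \<in> carrier_mat (2 ^ n) (2 ^ n)" "even L" "L \<le> k" "brickwork n \<alpha> L = cis \<phi> \<cdot>\<^sub>m U"
    unfolding reachable_def by blast
  from assms(2) obtain M \<beta> \<psi> where V: "V \<in> carrier_mat (2 ^ n) (2 ^ n)" "even M" "M \<le> l" "brickwork n \<beta> M = cis \<psi> \<cdot>\<^sub>m V"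
    unfolding reachable_def by blast
  \<comment> \<open>The right factor runs first: its angles occupy the rounds \<open>1\<close> to
    \<open>M\<close>, and those of the left factor are shifted by \<open>M\<close>.\<close>
  let ?\<gamma> = "\<lambda>i t. if t \<le> M then \<beta> i t else \<alpha> i (t - M)"
  have "brickwork n ?\<gamma> (M + L) = brickwork n (\<lambda>i u. ?\<gamma> i (M + u)) L * brickwork n ?\<gamma> M"
    by (rule brickwork_add[OF V(2)])
  also have "brickwork n (\<lambda>i u. ?\<gamma> i (M + u)) L = brickwork n \<alpha> L" by (rule brickwork_cong) simp
  also have "brickwork n ?\<gamma> M = brickwork n \<beta> M" by (rule brickwork_cong) simp
  also have "brickwork n \<alpha> L * brickwork n \<beta> M = cis (\<phi> + \<psi>) \<cdot>\<^sub>m (U * V)"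
    unfolding U(4) V(4) using U(1) V(1)
    by (simp add: mult_smult_distrib[of _ "2 ^ n" "2 ^ n" _ "2 ^ n"] mult_smult_assoc_mat[of _ "2 ^ n" "2 ^ n" _ "2 ^ n"]
        smult_smult_mat cis_mult mult.commute)
  finally show ?thesis
    unfolding reachable_def using U V assms(3)
    by (intro conjI exI[of _ "M + L"] exI[of _ ?\<gamma>] exI[of _ "\<phi> + \<psi>"]) auto
qed

lemma reachable_smult:
  assumes "reachable n k U" "cmod w = 1"
  shows "reachable n k (w \<cdot>\<^sub>m U)"
proof -
  from assms(1) obtain L \<alpha> \<phi> where U: "U \<in> carrier_mat (2 ^ n) (2 ^ n)" "even L" "L \<le> k" "brickwork n \<alpha> L = cis \<phi> \<cdot>\<^sub>m U"
    unfolding reachable_def by blast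
  have w: "w = cis (Arg w)" using assms(2) by (metis rcis_cmod_Arg rcis_def mult_1 of_real_1)
  have "cis (\<phi> - Arg w) \<cdot>\<^sub>m (w \<cdot>\<^sub>m U) = cis \<phi> \<cdot>\<^sub>m U"
    by (subst (2) w) (simp add: smult_smult_mat cis_mult)
  then show ?thesis unfolding reachable_def using U by (metis smult_carrier_mat)
qed

lemma reachable_mat_prod_list:
  assumes "\<And>M. M \<in> set Ms \<Longrightarrow> reachable n k M"
  shows "reachable n (length Ms * k) (mat_prod_list (2 ^ n) Ms)"
  using assms
proof (induction Ms)
  case Nil
  show ?case by (simp add: reachable_one)
next
  case (Cons M Ms)
  then have "reachable n k M" "reachable n (length Ms * k) (mat_prod_list (2 ^ n) Ms)" by auto
  then show ?case unfolding mat_prod_list_Cons by (rule reachable_mult) simp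
qed

lemma reachable_two_rounds:
  "reachable n 2 (rz_layer n \<beta> * (cz_o_layer n * (h_layer n * (rz_layer n \<gamma> * (cz_e_layer n * h_layer n)))))"
proof -
  let ?\<alpha> = "\<lambda>i t. if t = 1 then \<gamma> i else \<beta> i"
  have "brickwork n ?\<alpha> (Suc (Suc 0)) = rz_layer n \<beta> * (cz_o_layer n * (h_layer n * (rz_layer n \<gamma> * (cz_e_layer n * h_layer n))))"
    by (simp add: cz_layer_def square_mult_assoc[of _ "2 ^ n"])
  then show ?thesis unfolding reachable_def
    by (intro conjI exI[of _ "Suc (Suc 0)"] exI[of _ ?\<alpha>] exI[of _ 0]) (auto simp: smult_one_mat)
qed

section \<open>Rotation layers and rotations of a single qubit\<close>

lemma z_rotation_carrier [simp]: "z_rotation a \<in> carrier_mat 2 2"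
  by (auto simp: z_rotation_def mat_of_rows_list_def)

lemma z_rotation_index [simp]:
  "z_rotation a $$ (0, 0) = cis a" "z_rotation a $$ (0, Suc 0) = 0"
  "z_rotation a $$ (Suc 0, 0) = 0" "z_rotation a $$ (Suc 0, Suc 0) = cis (- a)"
  by (simp_all add: z_rotation_def mat_of_rows_list_def cis_conv_exp)

lemma z_rotation_diagonal: "diagonal_mat (z_rotation a)"
  using carrier_matD[OF z_rotation_carrier[of a]] by (auto simp: diagonal_mat_def less_2_iff)

lemma z_rotation_add: "z_rotation a * z_rotation b = z_rotation (a + b)"
  by (rule eq_mat_2I) (simp_all add: mult_mat_index_2 cis_mult del: index_mult_mat)

lemma z_rotation_0 [simp]: "z_rotation 0 = 1\<^sub>m 2"
  by (rule eq_mat_2I) simp_all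

lemma rz_layer_single:
  assumes "q \<in> {1..n}"
  shows "rz_layer n (\<lambda>i. if i = q then a else 0) = on_qubits n [q] (z_rotation a)"
proof -
  have "mat_prod_list (2 ^ n) (map (\<lambda>i. on_qubits n [i] (z_rotation (if i = q then a else 0))) qs) =
    (if q \<in> set qs then on_qubits n [q] (z_rotation a) else 1\<^sub>m (2 ^ n))" if "distinct qs" for qs
    using that by (induction qs) (auto simp: on_qubits_one_1)
  from this[of "[1..<n + 1]"] show ?thesis
    unfolding rz_layer_def using assms by (simp del: upt_Suc)
qed

lemma rz_layer_0: "rz_layer n (\<lambda>_. 0) = 1\<^sub>m (2 ^ n)"
proof -
  have "mat_prod_list (2 ^ n) (map (\<lambda>i. on_qubits n [i] (z_rotation 0)) qs) = 1\<^sub>m (2 ^ n)" for qs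
    by (induction qs) (auto simp: on_qubits_one_1)
  then show ?thesis unfolding rz_layer_def by blast
qed

lemma on_qubit_z_rotation_diagonal: "diagonal_mat (on_qubits n [i] (z_rotation a))"
  by (rule on_qubits_diagonal) (simp_all add: z_rotation_diagonal)

lemma rz_layer_diagonal: "diagonal_mat (rz_layer n \<beta>)"
  unfolding rz_layer_def by (rule mat_prod_list_diagonal) (auto simp: on_qubit_z_rotation_diagonal)

lemma on_qubits_controlled_z_diagonal: "diagonal_mat (on_qubits n [i, j] controlled_z)"
  by (rule on_qubits_diagonal) (simp_all add: controlled_z_diagonal)

lemma cz_layers_diagonal: "diagonal_mat (cz_e_layer n)" "diagonal_mat (cz_o_layer n)"
  unfolding cz_e_layer_def cz_o_layer_def
  by (rule mat_prod_list_diagonal, auto simp: on_qubits_controlled_z_diagonal)+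

text \<open>The inverse is the power just before the period, of depth
  \<open>2 * (2 ^ k - 1)\<close>, which is at most \<open>4 * n - 2\<close>.\<close>

lemma double_round_inverse:
  assumes "0 < n"
  obtains T' where "T' \<in> carrier_mat (2 ^ n) (2 ^ n)" "reachable n (4 * n - 2) T'"
    "double_round n * T' = 1\<^sub>m (2 ^ n)" "T' * double_round n = 1\<^sub>m (2 ^ n)"
proof -
  let ?T = "double_round n"
  obtain k where k: "n \<le> 2 ^ k" "2 ^ k \<le> 2 * n" using ex_power_2_between[OF assms] by blast
  obtain m where m: "2 ^ k = Suc m" by (metis not0_implies_Suc power_not_zero zero_neq_numeral)
  have T: "?T ^\<^sub>m l \<in> carrier_mat (2 ^ n) (2 ^ n)" for l by (rule pow_carrier_mat) simp
  have r: "reachable n 2 ?T"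
    using reachable_two_rounds[of n "\<lambda>_. 0" "\<lambda>_. 0"] by (simp add: rz_layer_0 double_round_def)
  have "reachable n (2 * l) (?T ^\<^sub>m l)" for l
  proof (induction l)
    case 0
    then show ?case by (simp add: carrier_matD[OF double_round_carrier] reachable_one)
  next
    case (Suc l)
    then show ?case unfolding pow_mat.simps by (rule reachable_mult[OF _ r]) simp
  qed
  then have "reachable n (4 * n - 2) (?T ^\<^sub>m m)" by (rule reachable_mono) (use k m in simp)
  moreover have "?T ^\<^sub>m m * ?T = 1\<^sub>m (2 ^ n)"
    using double_round_power_one[OF k(1)] unfolding m by simp
  moreover have "?T ^\<^sub>m l * ?T = ?T * ?T ^\<^sub>m l" for l
  proof (induction l)
    case (Suc l)
    then show ?case using T[of l] by (simp add: square_mult_assoc[of _ "2 ^ n"])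
  qed (simp add: carrier_matD[OF double_round_carrier])
  ultimately show thesis using that[of "?T ^\<^sub>m m"] T by metis
qed

text \<open>The rotations of the second round end the circuit, so the inverse of the bare circuit,
  run before it, leaves only them. The depth is \<open>2 + (4 * n - 2)\<close>.\<close>

lemma reachable_rz_layer:
  assumes "0 < n"
  shows "reachable n (4 * n) (rz_layer n \<beta>)"
proof -
  obtain T' where T': "T' \<in> carrier_mat (2 ^ n) (2 ^ n)" "reachable n (4 * n - 2) T'"
    "double_round n * T' = 1\<^sub>m (2 ^ n)" using double_round_inverse[OF assms] by metis
  have "reachable n 2 (rz_layer n \<beta> * double_round n)"
    using reachable_two_rounds[of n \<beta> "\<lambda>_. 0"] by (simp add: rz_layer_0 double_round_def)
  then have "reachable n (4 * n) (rz_layer n \<beta> * double_round n * T')"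
    by (rule reachable_mult[OF _ T'(2)]) (use assms in simp)
  then show ?thesis using T' by (simp add: square_mult_assoc[of _ "2 ^ n"])
qed

text \<open>The rotations of the first round are followed by a Hadamard layer, which is the source
  of rotations about X. Here the inverse is run after the two rounds.\<close>

lemma reachable_conj_rz_layer:
  assumes "0 < n"
  shows "reachable n (4 * n) (h_layer n * (rz_layer n \<gamma> * h_layer n))"
proof -
  let ?h = "h_layer n" and ?r = "rz_layer n \<gamma>"
  obtain T' where T': "T' \<in> carrier_mat (2 ^ n) (2 ^ n)" "reachable n (4 * n - 2) T'"
    "T' * double_round n = 1\<^sub>m (2 ^ n)" using double_round_inverse[OF assms] by metis
  \<comment> \<open>Commuting the diagonal rotations past \<open>cz_e_layer\<close> and inserting
    two cancelling Hadamard layers splits off \<open>double_round n\<close> on the left.\<close>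
  have "?r * (cz_e_layer n * ?h) = cz_e_layer n * (?r * ?h)"
    by (rule mult_swap_mat[where d = "2 ^ n"])
       (simp_all add: diagonal_commute[of _ "2 ^ n"] rz_layer_diagonal cz_layers_diagonal)
  moreover have "rz_layer n (\<lambda>_. 0) * (cz_o_layer n * (?h * (?r * (cz_e_layer n * ?h)))) =
      cz_o_layer n * (?h * (?r * (cz_e_layer n * ?h)))" by (simp add: rz_layer_0)
  ultimately have "reachable n 2 (cz_o_layer n * (?h * (cz_e_layer n * (?r * ?h))))"
    using reachable_two_rounds[of n "\<lambda>_. 0" \<gamma>] by simp
  also have "cz_o_layer n * (?h * (cz_e_layer n * (?r * ?h))) = double_round n * (?h * (?r * ?h))"
    by (simp add: double_round_def square_mult_assoc[of _ "2 ^ n"] mult_cancel_mat[of _ "2 ^ n"])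
  finally have "reachable n (4 * n) (T' * (double_round n * (?h * (?r * ?h))))"
    by (rule reachable_mult[OF T'(2)]) (use assms in simp)
  then show ?thesis using T' mult_cancel_mat[OF T'(1) double_round_carrier _ T'(3)] by simp
qed

text \<open>This is \<open>exp(i a X)\<close>, in the form in which the circuit produces it.\<close>

definition x_rotation :: "real \<Rightarrow> complex mat" where
  "x_rotation a = hadamard * z_rotation a * hadamard"

lemma x_rotation_carrier [simp]: "x_rotation a \<in> carrier_mat 2 2"
  by (simp add: x_rotation_def)

lemma h_layer_on_qubit:
  assumes "q \<in> {1..n}" "A \<in> carrier_mat 2 2"
  shows "h_layer n * on_qubits n [q] A = on_qubits n [q] (hadamard * A * hadamard) * h_layer n"
  using hadamards_on_qubit[of "[1..<n + 1]" n q A] assms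
  unfolding h_layer_eq by (simp add: atLeastLessThanSuc_atLeastAtMost del: upt_Suc)

lemma reachable_z_rotation:
  assumes "q \<in> {1..n}"
  shows "reachable n (4 * n) (on_qubits n [q] (z_rotation a))"
  using reachable_rz_layer[of n] assms unfolding rz_layer_single[OF assms, symmetric] by simp

lemma h_layer_conj_on_qubit:
  assumes "q \<in> {1..n}" "A \<in> carrier_mat 2 2"
  shows "h_layer n * (on_qubits n [q] A * h_layer n) = on_qubits n [q] (hadamard * A * hadamard)"
proof -
  have "h_layer n * (on_qubits n [q] A * h_layer n) = on_qubits n [q] (hadamard * A * hadamard) * (h_layer n * h_layer n)"
    by (rule mult_swap_mat[where d = "2 ^ n"]) (use h_layer_on_qubit[OF assms] in simp_all)
  then show ?thesis by simp
qed

lemma reachable_x_rotation: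
  assumes "q \<in> {1..n}"
  shows "reachable n (4 * n) (on_qubits n [q] (x_rotation a))"
  using reachable_conj_rz_layer[of n "\<lambda>i. if i = q then a else 0"] assms h_layer_conj_on_qubit[OF assms z_rotation_carrier]
  unfolding rz_layer_single[OF assms] x_rotation_def by simp

subsection \<open>One-qubit gates\<close>

lemma mat_adjoint_index:
  assumes "(A :: complex mat) \<in> carrier_mat m k" "i < k" "j < m"
  shows "mat_adjoint A $$ (i, j) = cnj (A $$ (j, i))"
  using assms unfolding mat_adjoint_def by (auto simp: mat_of_rows_index conjugate_vec_def)

lemma mat_adjoint_carrier [simp]: "A \<in> carrier_mat m k \<Longrightarrow> mat_adjoint A \<in> carrier_mat k m"
  by (auto simp: mat_adjoint_def)

lemma unitary_mat_carrier: "unitary_mat d U \<Longrightarrow> U \<in> carrier_mat d d"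
  by (simp add: unitary_mat_def)

lemma unitary_col_norm:
  assumes U: "unitary_mat d U" and j: "j < d"
  shows "(\<Sum>z < d. (cmod (U $$ (z, j)))\<^sup>2) = 1"
proof -
  have "(\<Sum>z < d. complex_of_real ((cmod (U $$ (z, j)))\<^sup>2)) = (\<Sum>z < d. mat_adjoint U $$ (j, z) * U $$ (z, j))"
    using j mat_adjoint_index[OF unitary_mat_carrier[OF U]]
    by (intro sum.cong) (auto simp: complex_norm_square mult.commute simp del: of_real_power)
  also have "\<dots> = (mat_adjoint U * U) $$ (j, j)"
    by (rule mult_mat_index[symmetric]) (use U j in \<open>auto simp: unitary_mat_def\<close>)
  also have "\<dots> = 1" using U j by (simp add: unitary_mat_def)
  finally have "complex_of_real (\<Sum>z < d. (cmod (U $$ (z, j)))\<^sup>2) = complex_of_real 1" by simp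
  then show ?thesis by (simp only: of_real_eq_iff)
qed

lemma unitary_row_norm:
  assumes U: "unitary_mat d U" and j: "j < d"
  shows "(\<Sum>z < d. (cmod (U $$ (j, z)))\<^sup>2) = 1"
proof -
  have "(\<Sum>z < d. complex_of_real ((cmod (U $$ (j, z)))\<^sup>2)) = (\<Sum>z < d. U $$ (j, z) * mat_adjoint U $$ (z, j))"
    using j mat_adjoint_index[OF unitary_mat_carrier[OF U]]
    by (intro sum.cong) (auto simp: complex_norm_square simp del: of_real_power)
  also have "\<dots> = (U * mat_adjoint U) $$ (j, j)"
    by (rule mult_mat_index[symmetric]) (use U j in \<open>auto simp: unitary_mat_def\<close>)
  also have "\<dots> = 1" using U j by (simp add: unitary_mat_def)
  finally have "complex_of_real (\<Sum>z < d. (cmod (U $$ (j, z)))\<^sup>2) = complex_of_real 1" by simp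
  then show ?thesis by (simp only: of_real_eq_iff)
qed

lemma mat_adjoint_mult:
  assumes A: "(A :: complex mat) \<in> carrier_mat d d" and B: "B \<in> carrier_mat d d"
  shows "mat_adjoint (A * B) = mat_adjoint B * mat_adjoint A"
proof (rule eq_matI)
  fix i j assume "i < dim_row (mat_adjoint B * mat_adjoint A)" "j < dim_col (mat_adjoint B * mat_adjoint A)"
  then have ij: "i < d" "j < d" using mat_adjoint_carrier[OF A] mat_adjoint_carrier[OF B] by auto
  have "mat_adjoint (A * B) $$ (i, j) = cnj ((A * B) $$ (j, i))"
    by (rule mat_adjoint_index) (use A B ij in auto)
  also have "\<dots> = (\<Sum>z < d. cnj (A $$ (j, z)) * cnj (B $$ (z, i)))"
    by (subst mult_mat_index[OF A B]) (use ij in auto)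
  also have "\<dots> = (\<Sum>z < d. mat_adjoint B $$ (i, z) * mat_adjoint A $$ (z, j))"
    using ij by (intro sum.cong) (auto simp: mat_adjoint_index[OF A] mat_adjoint_index[OF B])
  also have "\<dots> = (mat_adjoint B * mat_adjoint A) $$ (i, j)"
    by (rule mult_mat_index[symmetric]) (use A B ij in auto)
  finally show "mat_adjoint (A * B) $$ (i, j) = (mat_adjoint B * mat_adjoint A) $$ (i, j)" .
qed (use carrier_matD[OF mat_adjoint_carrier[OF square_mult_carrier[OF A B]]]
      carrier_matD[OF mat_adjoint_carrier[OF A]] carrier_matD[OF mat_adjoint_carrier[OF B]] in auto)

lemma unitary_mult:
  assumes A: "unitary_mat d A" and B: "unitary_mat d B"
  shows "unitary_mat d (A * B)"
proof -
  note c = A[unfolded unitary_mat_def] B[unfolded unitary_mat_def]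
  have "mat_adjoint B * mat_adjoint A * (A * B) = mat_adjoint B * (mat_adjoint A * (A * B))"
    using c by (intro square_mult_assoc[where d = d]) simp_all
  also have "mat_adjoint A * (A * B) = B"
    by (rule mult_cancel_mat[where d = d]) (use c in simp_all)
  finally have 1: "mat_adjoint B * mat_adjoint A * (A * B) = 1\<^sub>m d" using c by simp
  have "A * B * (mat_adjoint B * mat_adjoint A) = A * (B * (mat_adjoint B * mat_adjoint A))"
    using c by (intro square_mult_assoc[where d = d]) simp_all
  also have "B * (mat_adjoint B * mat_adjoint A) = mat_adjoint A"
    by (rule mult_cancel_mat[where d = d]) (use c in simp_all)
  finally have 2: "A * B * (mat_adjoint B * mat_adjoint A) = 1\<^sub>m d" using c by simp
  show ?thesis using c 1 2 by (simp add: unitary_mat_def mat_adjoint_mult[of A d B])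
qed

lemma hermitian_involution_unitary:
  assumes "U \<in> carrier_mat d d" "U * U = 1\<^sub>m d" "\<And>i j. i < d \<Longrightarrow> j < d \<Longrightarrow> cnj (U $$ (j, i)) = U $$ (i, j)"
  shows "unitary_mat d U"
proof -
  have "mat_adjoint U = U"
    using assms mat_adjoint_index[OF assms(1)] carrier_matD[OF mat_adjoint_carrier[OF assms(1)]]
    by (intro eq_matI) auto
  then show ?thesis using assms by (simp add: unitary_mat_def)
qed

lemma hadamard_unitary: "unitary_mat 2 hadamard"
  by (rule hermitian_involution_unitary) (auto simp: less_2_iff)

lemma z_rotation_adjoint: "mat_adjoint (z_rotation a) = z_rotation (- a)"
  by (rule eq_mat_2I) (simp_all add: mat_adjoint_index[OF z_rotation_carrier] cis_cnj)

lemma z_rotation_unitary: "unitary_mat 2 (z_rotation a)"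
  by (simp add: unitary_mat_def z_rotation_adjoint z_rotation_add)

lemma x_rotation_unitary: "unitary_mat 2 (x_rotation a)"
  unfolding x_rotation_def by (intro unitary_mult hadamard_unitary z_rotation_unitary)

lemma x_rotation_add: "x_rotation a * x_rotation b = x_rotation (a + b)"
  unfolding x_rotation_def z_rotation_add[symmetric]
  by (simp add: square_mult_assoc[of _ 2] mult_cancel_mat[of _ 2])

lemma x_rotation_0: "x_rotation 0 = 1\<^sub>m 2"
  by (simp add: x_rotation_def)

lemma x_rotation_index [simp]:
  "x_rotation a $$ (0, 0) = complex_of_real (cos a)" "x_rotation a $$ (0, Suc 0) = \<i> * complex_of_real (sin a)"
  "x_rotation a $$ (Suc 0, 0) = \<i> * complex_of_real (sin a)" "x_rotation a $$ (Suc 0, Suc 0) = complex_of_real (cos a)"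
proof -
  have s: "complex_of_real (1 / sqrt 2) * (z * complex_of_real (1 / sqrt 2)) = z / 2" for z
    using half_sqrt_2 by (simp add: algebra_simps del: of_real_divide)
  have *: "x_rotation a $$ (i, j) = hadamard $$ (i, 0) * (cis a * hadamard $$ (0, j)) + hadamard $$ (i, 1) * (cis (- a) * hadamard $$ (1, j))"
    if "i < 2" "j < 2" for i j
    using that by (simp add: x_rotation_def mult_mat_index_2 algebra_simps del: index_mult_mat)
  show "x_rotation a $$ (0, 0) = complex_of_real (cos a)" "x_rotation a $$ (0, Suc 0) = \<i> * complex_of_real (sin a)"
    "x_rotation a $$ (Suc 0, 0) = \<i> * complex_of_real (sin a)" "x_rotation a $$ (Suc 0, Suc 0) = complex_of_real (cos a)"
    by (simp_all add: * s del: of_real_divide) (simp_all add: complex_eq_iff)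
qed

lemma cmod_eq_1I: "(cmod z)\<^sup>2 = 1 \<Longrightarrow> cmod z = 1"
  using abs_square_eq_1[of "cmod z"] by simp

text \<open>The first column has norm one, so its top entry has modulus one; the norm of the first
  row then forces the other off-diagonal entry to vanish.\<close>

lemma unitary_2_diagonal:
  assumes V: "unitary_mat 2 V" and "V $$ (1, 0) = 0"
  shows "\<exists>w c. cmod w = 1 \<and> V = w \<cdot>\<^sub>m z_rotation c"
proof -
  have "(cmod (V $$ (0, 0)))\<^sup>2 = 1"
    using unitary_col_norm[OF V, of 0] assms by (simp add: sum_lessThan_2)
  moreover have "(cmod (V $$ (0, 0)))\<^sup>2 + (cmod (V $$ (0, 1)))\<^sup>2 = 1"
    using unitary_row_norm[OF V, of 0] by (simp add: sum_lessThan_2)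
  ultimately have 01: "V $$ (0, 1) = 0" and n0: "cmod (V $$ (0, 0)) = 1" by (auto intro: cmod_eq_1I)
  have "(cmod (V $$ (1, 1)))\<^sup>2 = 1"
    using unitary_col_norm[OF V, of 1] 01 by (simp add: sum_lessThan_2)
  then have n1: "cmod (V $$ (1, 1)) = 1" by (rule cmod_eq_1I)
  let ?s = "Arg (V $$ (0, 0))" and ?t = "Arg (V $$ (1, 1))"
  have "V $$ (0, 0) = cis ?s" "V $$ (1, 1) = cis ?t"
    using n0 n1 rcis_cmod_Arg by (metis rcis_def mult_1 of_real_1)+
  \<comment> \<open>The mean of the two phases is the global phase, half their difference the
    rotation angle.\<close>
  then have "V = cis ((?s + ?t) / 2) \<cdot>\<^sub>m z_rotation ((?s - ?t) / 2)"
    using 01 assms(2) unitary_mat_carrier[OF V]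
    by (intro eq_mat_2I) (simp_all add: cis_mult field_simps carrier_matD[OF z_rotation_carrier])
  then show ?thesis by (intro exI conjI) (rule norm_cis, assumption)
qed

text \<open>A Z rotation aligns the phases of the first column and an X rotation then clears its
  lower entry; what remains is diagonal.\<close>

lemma euler_decomposition:
  assumes U: "unitary_mat 2 U"
  shows "\<exists>w a b c. cmod w = 1 \<and> U = w \<cdot>\<^sub>m (z_rotation a * (x_rotation b * z_rotation c))"
proof -
  define A C where "A = Arg (U $$ (0, 0))" and "C = Arg (U $$ (1, 0))"
  have "(cmod (U $$ (0, 0)))\<^sup>2 + (cmod (U $$ (1, 0)))\<^sup>2 = 1"
    using unitary_col_norm[OF U, of 0] by (simp add: sum_lessThan_2)
  then obtain b where b: "cmod (U $$ (0, 0)) = cos b" "cmod (U $$ (1, 0)) = sin b"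
    using sincos_total_pi_half by (metis norm_ge_zero)
  have u: "U $$ (0, 0) = cos b * cis A" "U $$ (1, 0) = sin b * cis C"
    using rcis_cmod_Arg[of "U $$ (0, 0)"] rcis_cmod_Arg[of "U $$ (1, 0)"] unfolding b rcis_def A_def[symmetric] C_def[symmetric] by simp_all
  \<comment> \<open>This value solves \<open>pi / 2 + a + A = pi + (C - a)\<close>, so that the two
    contributions to the lower left entry of \<open>V\<close> have opposite signs.\<close>
  define a where "a = (C - A + pi / 2) / 2"
  define V where "V = x_rotation b * (z_rotation a * U)"
  have Uc: "U \<in> carrier_mat 2 2" by (rule unitary_mat_carrier[OF U])
  have V: "unitary_mat 2 V" unfolding V_def by (intro unitary_mult x_rotation_unitary z_rotation_unitary U)
  have "V $$ (1, 0) = \<i> * sin b * (cis a * U $$ (0, 0)) + cos b * (cis (- a) * U $$ (1, 0))"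
    using Uc by (simp add: V_def mult_mat_index_2 del: index_mult_mat)
  also have "\<dots> = sin b * cos b * (cis (pi / 2) * cis a * cis A + cis (- a) * cis C)"
    unfolding u by (simp add: algebra_simps)
  also have "cis (pi / 2) * cis a * cis A = cis (pi + (- a + C))"
  proof -
    have "pi / 2 + a + A = pi + (- a + C)" by (simp add: a_def field_simps)
    then show ?thesis by (simp only: cis_mult)
  qed
  also have "cis (pi + (- a + C)) = - (cis (- a) * cis C)" by (simp only: cis_mult[symmetric] cis_pi) simp
  finally have "V $$ (1, 0) = 0" by simp
  then obtain w c where w: "cmod w = 1" "V = w \<cdot>\<^sub>m z_rotation c" using unitary_2_diagonal[OF V] by blast
  have "z_rotation (- a) * (x_rotation (- b) * V) = U"
    unfolding V_def using Uc
    by (simp add: mult_cancel_mat[of _ 2] x_rotation_add z_rotation_add x_rotation_0)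
  moreover have "z_rotation (- a) * (x_rotation (- b) * V) = w \<cdot>\<^sub>m (z_rotation (- a) * (x_rotation (- b) * z_rotation c))"
    unfolding w by (simp add: mult_smult_distrib[of _ 2 2 _ 2])
  ultimately show ?thesis using w(1) by metis
qed

lemma reachable_one_qubit:
  assumes q: "q \<in> {1..n}" and U: "unitary_mat 2 U"
  shows "reachable n (12 * n) (on_qubits n [q] U)"
proof -
  obtain w a b c where w: "cmod w = 1" "U = w \<cdot>\<^sub>m (z_rotation a * (x_rotation b * z_rotation c))"
    using euler_decomposition[OF U] by blast
  have "reachable n (8 * n) (on_qubits n [q] (x_rotation b) * on_qubits n [q] (z_rotation c))"
    by (rule reachable_mult[OF reachable_x_rotation[OF q] reachable_z_rotation[OF q]]) simp
  then have "reachable n (12 * n) (on_qubits n [q] (z_rotation a) * (on_qubits n [q] (x_rotation b) * on_qubits n [q] (z_rotation c)))"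
    by (rule reachable_mult[OF reachable_z_rotation[OF q]]) simp
  then have "reachable n (12 * n) (on_qubits n [q] (z_rotation a * (x_rotation b * z_rotation c)))"
    using q by (simp add: on_qubits_mult_1)
  then show ?thesis unfolding w(2)
    using w(1) by (subst on_qubits_smult) (auto intro: reachable_smult)
qed

text \<open>Every round couples the Hadamard layer to a controlled-Z layer, so the bare layer is
  assembled from \<open>n\<close> one-qubit gates of depth \<open>12 * n\<close> each. It serves to
  undo an outer conjugation below.\<close>

lemma reachable_h_layer: "reachable n (12 * n ^ 2) (h_layer n)"
proof -
  have "reachable n (length (map (\<lambda>i. on_qubits n [i] hadamard) [1..<n + 1]) * (12 * n)) (h_layer n)"
    unfolding h_layer_def by (rule reachable_mat_prod_list) (auto simp: reachable_one_qubit hadamard_unitary)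
  then show ?thesis by (simp add: power2_eq_square ac_simps del: upt_Suc)
qed

lemma on_qubits_controlled_z_square:
  assumes "i \<in> {1..n}" "j \<in> {1..n}" "i \<noteq> j"
  shows "on_qubits n [i, j] controlled_z * on_qubits n [i, j] controlled_z = 1\<^sub>m (2 ^ n)"
proof -
  have "controlled_z * controlled_z = 1\<^sub>m 4"
    by (rule eq_mat_4I) (auto simp: mult_mat_index_4 controlled_z_index simp del: index_mult_mat)
  then show ?thesis using assms by (simp add: on_qubits_mult_2 on_qubits_one_2)
qed

text \<open>The pairs in a layer are disjoint: all gates but the one touching qubit \<open>i\<close>
  commute with the operator on that qubit, so conjugation with the whole layer acts like conjugation
  with this one gate.\<close>

lemma controlled_z_prod_intertwine:
  assumes "distinct ks" "k0 \<in> set ks" "i = a k0" and A: "A \<in> carrier_mat 2 2"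
    and ab: "\<And>k. k \<in> set ks \<Longrightarrow> a k \<in> {1..n} \<and> b k \<in> {1..n} \<and> a k \<noteq> b k"
    and disj: "\<And>k. k \<in> set ks \<Longrightarrow> k \<noteq> k0 \<Longrightarrow> i \<noteq> a k \<and> i \<noteq> b k"
  defines "M \<equiv> \<lambda>k. on_qubits n [a k, b k] controlled_z"
  shows "mat_prod_list (2 ^ n) (map M ks) * on_qubits n [i] A =
    (M k0 * (on_qubits n [i] A * M k0)) * mat_prod_list (2 ^ n) (map M ks)"
proof -
  have i: "i \<in> {1..n}" using assms(2,3) ab by auto
  have M: "M k \<in> carrier_mat (2 ^ n) (2 ^ n)" for k by (simp add: M_def)
  have P: "mat_prod_list (2 ^ n) (map M ls) \<in> carrier_mat (2 ^ n) (2 ^ n)" for ls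
    by (rule mat_prod_list_carrier) (use M in auto)
  have com: "M k * on_qubits n [i] A = on_qubits n [i] A * M k" if "k \<in> set ks" "k \<noteq> k0" for k
    unfolding M_def by (rule on_qubits_commute) (use ab[OF that(1)] disj[OF that] i in auto)
  have MM: "M k * M l = M l * M k" for k l
    by (rule diagonal_commute[where d = "2 ^ n"]) (simp_all add: M_def on_qubits_controlled_z_diagonal)
  have sq: "M k0 * M k0 = 1\<^sub>m (2 ^ n)"
    unfolding M_def by (rule on_qubits_controlled_z_square) (use assms(2) ab in auto)
  have rest: "mat_prod_list (2 ^ n) (map M ls) * on_qubits n [i] A = on_qubits n [i] A * mat_prod_list (2 ^ n) (map M ls)"
    if "set ls \<subseteq> set ks - {k0}" for ls
    using that
  proof (induction ls)
    case (Cons l ls)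
    then show ?case unfolding list.map mat_prod_list_Cons
      by (intro intertwine_mult[where d = "2 ^ n"]) (use M P com in auto)
  qed simp
  have "mat_prod_list (2 ^ n) (map M ls) * on_qubits n [i] A =
    (M k0 * (on_qubits n [i] A * M k0)) * mat_prod_list (2 ^ n) (map M ls)"
    if "distinct ls" "set ls \<subseteq> set ks" "k0 \<in> set ls" for ls
    using that
  proof (induction ls)
    case (Cons l ls)
    show ?case
    proof (cases "l = k0")
      case True
      then have "mat_prod_list (2 ^ n) (map M ls) * on_qubits n [i] A = on_qubits n [i] A * mat_prod_list (2 ^ n) (map M ls)"
        using Cons.prems by (intro rest) auto
      then show ?thesis using True M P sq
        by (simp add: square_mult_assoc[of _ "2 ^ n"] mult_cancel_mat[of _ "2 ^ n"])
    next
      case False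
      have "M l * (M k0 * (on_qubits n [i] A * M k0)) = M k0 * (M l * (on_qubits n [i] A * M k0))"
        by (rule mult_swap_mat[where d = "2 ^ n"]) (use M MM in auto)
      also have "M l * (on_qubits n [i] A * M k0) = on_qubits n [i] A * (M l * M k0)"
        by (rule mult_swap_mat[where d = "2 ^ n"]) (use M com[of l] Cons.prems False in auto)
      also have "M l * M k0 = M k0 * M l" by (rule MM)
      finally have "M l * (M k0 * (on_qubits n [i] A * M k0)) = (M k0 * (on_qubits n [i] A * M k0)) * M l"
        using M by (simp add: square_mult_assoc[of _ "2 ^ n"])
      then show ?thesis unfolding list.map mat_prod_list_Cons
        by (intro intertwine_mult[where d = "2 ^ n", where B = "M k0 * (on_qubits n [i] A * M k0)"])
           (use M P Cons False in auto)
    qed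
  qed simp
  from this[OF assms(1) _ assms(2)] show ?thesis by simp
qed

subsection \<open>Controlled-Z gates\<close>

lemma controlled_z_prod_conj:
  assumes "distinct ks" "k0 \<in> set ks" "i = a k0" and A: "A \<in> carrier_mat 2 2"
    and ab: "\<And>k. k \<in> set ks \<Longrightarrow> a k \<in> {1..n} \<and> b k \<in> {1..n} \<and> a k \<noteq> b k"
    and disj: "\<And>k. k \<in> set ks \<Longrightarrow> k \<noteq> k0 \<Longrightarrow> i \<noteq> a k \<and> i \<noteq> b k"
  defines "P \<equiv> mat_prod_list (2 ^ n) (map (\<lambda>k. on_qubits n [a k, b k] controlled_z) ks)"
  shows "P * (on_qubits n [i] A * P) =
    on_qubits n [i, b k0] controlled_z * (on_qubits n [i] A * on_qubits n [i, b k0] controlled_z)"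
    and "P * P = 1\<^sub>m (2 ^ n)"
proof -
  let ?M = "on_qubits n [i, b k0] controlled_z" and ?A = "on_qubits n [i] A"
  have P: "P \<in> carrier_mat (2 ^ n) (2 ^ n)" unfolding P_def by (rule mat_prod_list_carrier) auto
  show PP: "P * P = 1\<^sub>m (2 ^ n)" unfolding P_def
    by (rule mat_prod_list_diagonal_square)
       (use ab in \<open>auto simp: on_qubits_controlled_z_diagonal on_qubits_controlled_z_square\<close>)
  have "P * ?A = ?M * (?A * ?M) * P"
    using controlled_z_prod_intertwine[of ks k0 i a A n b] assms(1-4) ab disj unfolding P_def by simp
  then have "P * (?A * P) = ?M * (?A * ?M) * (P * P)"
    by (intro mult_swap_mat[where d = "2 ^ n"]) (use P in simp_all)
  then show "P * (?A * P) = ?M * (?A * ?M)" by (simp add: PP)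
qed

lemma cz_o_layer_conj:
  assumes k: "1 \<le> k" "k < n div 2" and A: "A \<in> carrier_mat 2 2"
  shows "cz_o_layer n * (on_qubits n [2 * k] A * cz_o_layer n) =
    on_qubits n [2 * k, Suc (2 * k)] controlled_z *
      (on_qubits n [2 * k] A * on_qubits n [2 * k, Suc (2 * k)] controlled_z)"
  using controlled_z_prod_conj(1)[of "[1..<n div 2]" k "2 * k" "\<lambda>k. 2 * k" A n "\<lambda>k. 2 * k + 1"] assms
  unfolding cz_o_layer_def by fastforce

lemma cz_o_layer_square: "cz_o_layer n * cz_o_layer n = 1\<^sub>m (2 ^ n)"
  unfolding cz_o_layer_def
  by (rule mat_prod_list_diagonal_square)
     (auto simp: on_qubits_controlled_z_diagonal intro!: on_qubits_controlled_z_square)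

lemma cz_e_layer_square: "cz_e_layer n * cz_e_layer n = 1\<^sub>m (2 ^ n)"
  unfolding cz_e_layer_def
  by (rule mat_prod_list_diagonal_square)
     (auto simp: on_qubits_controlled_z_diagonal intro!: on_qubits_controlled_z_square)

lemma cz_e_layer_conj:
  assumes k: "1 \<le> k" "k \<le> n div 2" and A: "A \<in> carrier_mat 2 2"
  shows "cz_e_layer n * (on_qubits n [2 * k - 1] A * cz_e_layer n) =
    on_qubits n [2 * k - 1, 2 * k] controlled_z *
      (on_qubits n [2 * k - 1] A * on_qubits n [2 * k - 1, 2 * k] controlled_z)"
  unfolding cz_e_layer_def
proof (rule controlled_z_prod_conj(1)[where a = "\<lambda>k. 2 * k - 1" and b = "\<lambda>k. 2 * k"])
  fix l assume "l \<in> set [1..<n div 2 + 1]"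
  then have l: "1 \<le> l" "l \<le> n div 2" by auto
  then show "2 * l - 1 \<in> {1..n} \<and> 2 * l \<in> {1..n} \<and> 2 * l - 1 \<noteq> 2 * l" by auto
  show "2 * k - 1 \<noteq> 2 * l - 1 \<and> 2 * k - 1 \<noteq> 2 * l" if "l \<noteq> k" using l k that by presburger
qed (use k A in auto)

text \<open>
  The layer \<open>cz_o_layer\<close> or \<open>cz_e_layer\<close> that contains the pair \<open>(j, j + 1)\<close> is exposed by
  conjugating a rotation of qubit \<open>j\<close> with the two-round circuit or with its inverse.
\<close>

lemma reachable_conj_x_rotation:
  assumes n: "even n" and j: "1 \<le> j" "j < n"
  defines "M \<equiv> on_qubits n [j, Suc j] controlled_z"
  shows "reachable n (32 * n ^ 2) (M * (on_qubits n [j] (x_rotation a) * M))"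
proof -
  let ?d = "2 ^ n :: nat"
  let ?T = "double_round n" and ?h = "h_layer n" and ?o = "cz_o_layer n" and ?e = "cz_e_layer n"
  let ?X = "on_qubits n [j] (x_rotation a)" and ?Z = "on_qubits n [j] (z_rotation a)"
  define E where "E = ?h * (?e * ?h)"
  have E: "E \<in> carrier_mat ?d ?d" by (simp add: E_def)
  have jn: "j \<in> {1..n}" using j by simp
  have n0: "0 < n" using j by simp
  have EE: "E * E = 1\<^sub>m ?d"
    by (simp add: E_def square_mult_assoc[of _ ?d] mult_cancel_mat[of _ ?d] cz_e_layer_square)
  have T: "?T = ?o * E" by (simp add: double_round_def E_def)
  obtain T' where T': "T' \<in> carrier_mat ?d ?d" "reachable n (4 * n - 2) T'"
    "?T * T' = 1\<^sub>m ?d" "T' * ?T = 1\<^sub>m ?d" using double_round_inverse[OF n0] by metis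
  have rT: "reachable n 2 ?T"
    using reachable_two_rounds[of n "\<lambda>_. 0" "\<lambda>_. 0"] by (simp add: rz_layer_0 double_round_def)
  have le: "8 * n \<le> 8 * n ^ 2" using n0 by (simp add: power2_eq_square)
  have hZ: "?h * ?Z = ?X * ?h" using h_layer_on_qubit[OF jn z_rotation_carrier] by (simp add: x_rotation_def)
  have hX: "?h * ?X = ?Z * ?h"
    using h_layer_on_qubit[OF jn x_rotation_carrier, of a]
    by (simp add: x_rotation_def square_mult_assoc[of _ 2] mult_cancel_mat[of _ 2])
  have oZ: "?o * ?Z = ?Z * ?o" and eZ: "?e * ?Z = ?Z * ?e"
    by (rule diagonal_commute[where d = ?d]; simp add: cz_layers_diagonal on_qubit_z_rotation_diagonal)+
  show ?thesis
  proof (cases "even j")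
    case True
    then obtain k where k: "j = 2 * k" by blast
    then have k': "1 \<le> k" "k < n div 2" using j n by auto
    \<comment> \<open>\<open>E\<close> is a diagonal layer conjugated by Hadamard gates and thus
      commutes with X rotations. Moved past \<open>?X\<close> it meets \<open>T'\<close>, and
      \<open>E * T' = ?o\<close> because \<open>?T = ?o * E\<close>.\<close>
    have EX: "E * ?X = ?X * E"
      unfolding E_def
      by (rule intertwine_mult[where d = ?d, OF _ _ _ _ _ hZ intertwine_mult[where d = ?d, OF _ _ _ _ _ eZ hX]]) simp_all
    have "?o * (E * T') = 1\<^sub>m ?d" using T'(1,3) E by (simp add: T square_mult_assoc[of _ ?d])
    then have "?o * (?o * (E * T')) = ?o" by simp
    then have ET: "E * T' = ?o"
      using mult_cancel_mat[OF _ _ _ cz_o_layer_square, of n "E * T'"] E T'(1) by simp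
    have "E * (?X * T') = ?X * (E * T')"
      by (rule mult_swap_mat[where d = ?d]) (use E EX T'(1) in simp_all)
    then have "?T * (?X * T') = ?o * (?X * ?o)"
      using E T'(1) ET by (simp add: T square_mult_assoc[of _ ?d])
    also have "\<dots> = M * (?X * M)"
      unfolding M_def k by (rule cz_o_layer_conj[OF k']) simp
    finally have eq: "?T * (?X * T') = M * (?X * M)" .
    have "reachable n (8 * n - 2) (?X * T')"
      by (rule reachable_mult[OF reachable_x_rotation[OF jn] T'(2)]) (use n0 in simp)
    then have "reachable n (8 * n) (?T * (?X * T'))" by (rule reachable_mult[OF rT]) (use n0 in simp)
    then show ?thesis unfolding eq by (rule reachable_mono) (use le in simp)
  next
    case False
    then obtain k0 where k0: "j = 2 * k0 + 1" by (rule oddE)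
    define k where "k = Suc k0"
    have k: "j = 2 * k - 1" "Suc j = 2 * k" "1 \<le> k" "k \<le> n div 2"
      using k0 j n by (auto simp: k_def)
    have "T' * ?o * E = 1\<^sub>m ?d" using T'(1,4) E by (simp add: T square_mult_assoc[of _ ?d])
    then have "T' * ?o * E * E = E" using E by simp
    moreover have "T' * ?o * E * E = T' * ?o" using T'(1) E EE by (simp add: square_mult_assoc[of _ ?d])
    ultimately have TE: "T' * ?o = E" by simp
    \<comment> \<open>The Z rotation commutes with \<open>?o\<close>, and
      \<open>T' * ?o = E\<close>, so \<open>E * (?Z * E)\<close> remains. The outer Hadamard layers
      turn this into the X rotation conjugated by \<open>?e\<close>.\<close>
    have "T' * (?Z * ?T) = T' * (?o * (?Z * E))"
      unfolding T using mult_swap_mat[of ?Z ?d ?o ?o E ?Z] E oZ by simp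
    also have "\<dots> = E * (?Z * E)"
      using T'(1) E TE square_mult_assoc[of T' ?d ?o "?Z * E"] by simp
    finally have "?h * (T' * (?Z * ?T) * ?h) = ?h * (E * (?Z * E) * ?h)" by simp
    also have "\<dots> = ?e * ((?h * (?Z * ?h)) * ?e)"
      by (simp add: E_def square_mult_assoc[of _ ?d] mult_cancel_mat[of _ ?d])
    also have "?h * (?Z * ?h) = ?X"
      using h_layer_conj_on_qubit[OF jn z_rotation_carrier] by (simp add: x_rotation_def)
    also have "?e * (?X * ?e) = M * (?X * M)"
      unfolding M_def k(2) unfolding k(1) by (rule cz_e_layer_conj[OF k(3,4)]) simp
    finally have eq: "?h * (T' * (?Z * ?T) * ?h) = M * (?X * M)" .
    have "reachable n (4 * n + 2) (?Z * ?T)"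
      by (rule reachable_mult[OF reachable_z_rotation[OF jn] rT]) simp
    then have "reachable n (8 * n) (T' * (?Z * ?T))" by (rule reachable_mult[OF T'(2)]) (use n0 in simp)
    then have "reachable n (8 * n + 12 * n ^ 2) (T' * (?Z * ?T) * ?h)"
      by (rule reachable_mult[OF _ reachable_h_layer]) simp
    \<comment> \<open>The two explicit Hadamard layers dominate the cost:
      \<open>8 * n + 2 * (12 * n ^ 2)\<close>.\<close>
    then have "reachable n (32 * n ^ 2) (?h * (T' * (?Z * ?T) * ?h))"
      by (rule reachable_mult[OF reachable_h_layer]) (use le in simp)
    then show ?thesis unfolding eq .
  qed
qed

text \<open>The operator \<open>exp(i a Z Z)\<close>: the sign of the phase is the parity of the two
  bits.\<close>

definition zz_rotation :: "real \<Rightarrow> complex mat" where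
  "zz_rotation a = mat 4 4 (\<lambda>(r, c). if r = c then if r \<in> {0, 3} then cis a else cis (- a) else 0)"

lemma zz_rotation_carrier [simp]: "zz_rotation a \<in> carrier_mat 4 4"
  by (simp add: zz_rotation_def)

text \<open>Both sides are \<open>exp(i a X Z)\<close>: a Hadamard gate on the first qubit takes
  \<open>Z Z\<close> to \<open>X Z\<close>, and conjugation by controlled-Z takes X on the first
  qubit to \<open>X Z\<close>.\<close>

lemma hadamard_zz_rotation:
  "kron2 hadamard (1\<^sub>m 2) * (zz_rotation a * kron2 hadamard (1\<^sub>m 2)) =
    controlled_z * (kron2 (x_rotation a) (1\<^sub>m 2) * controlled_z)"
proof -
  have s: "complex_of_real (1 / sqrt 2) * (z * complex_of_real (1 / sqrt 2)) = z / 2" for z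
    using half_sqrt_2 by (simp add: algebra_simps del: of_real_divide)
  show ?thesis
    by (rule eq_mat_4I)
       (auto simp: mult_mat_index_4 kron2_index controlled_z_index zz_rotation_def s
         simp del: index_mult_mat of_real_divide, simp_all add: complex_eq_iff)
qed

lemma zz_rotation_eq:
  "zz_rotation a = kron2 hadamard (1\<^sub>m 2) * (controlled_z * (kron2 (x_rotation a) (1\<^sub>m 2) *
     (controlled_z * kron2 hadamard (1\<^sub>m 2))))"
proof -
  let ?H = "kron2 hadamard (1\<^sub>m 2)"
  have H: "?H * ?H = 1\<^sub>m 4" by (simp add: kron2_mult kron2_one)
  have "?H * (?H * (zz_rotation a * ?H) * ?H) = zz_rotation a"
    by (simp add: square_mult_assoc[of _ 4] mult_cancel_mat[of _ 4] H)
  then show ?thesis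
    unfolding hadamard_zz_rotation by (simp add: square_mult_assoc[of _ 4])
qed

text \<open>Controlled-Z is the exponential of \<open>i pi / 4\<close> times
  \<open>(1 - Z) (1 - Z)\<close> with one factor per qubit; expanding gives the phase, the two Z
  rotations and the ZZ rotation.\<close>

lemma controlled_z_eq_zz_rotation:
  "controlled_z = cis (pi / 4) \<cdot>\<^sub>m
     (zz_rotation (pi / 4) * kron2 (z_rotation (- pi / 4)) (z_rotation (- pi / 4)))"
proof -
  have *: "cis (pi / 4) * (cis (pi / 4) * z) = \<i> * z" for z
    by (simp add: cis_mult flip: mult.assoc)
  show ?thesis
    by (rule eq_mat_4I)
       (auto simp: mult_mat_index_4 kron2_index controlled_z_index zz_rotation_def cis_mult *
         simp del: index_mult_mat(1))
qed

text \<open>Gate counting on one pair, independent of \<open>n\<close> and of the position of the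
  pair. Phases are free, and the arbitrary \<open>k\<close> for the identity makes the index an
  upper bound.\<close>

inductive pair_circuit :: "nat \<Rightarrow> complex mat \<Rightarrow> bool" where
  pair_circuit_one: "pair_circuit k (1\<^sub>m 4)"
| pair_circuit_first: "pair_circuit k U \<Longrightarrow> unitary_mat 2 A \<Longrightarrow> pair_circuit (Suc k) (kron2 A (1\<^sub>m 2) * U)"
| pair_circuit_second: "pair_circuit k U \<Longrightarrow> unitary_mat 2 A \<Longrightarrow> pair_circuit (Suc k) (kron2 (1\<^sub>m 2) A * U)"
| pair_circuit_cz: "pair_circuit k U \<Longrightarrow> pair_circuit (Suc k) (controlled_z * U)"
| pair_circuit_phase: "pair_circuit k U \<Longrightarrow> cmod w = 1 \<Longrightarrow> pair_circuit k (w \<cdot>\<^sub>m U)"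

lemma pair_circuit_carrier: "pair_circuit k U \<Longrightarrow> U \<in> carrier_mat 4 4"
  by (induction rule: pair_circuit.induct) auto

lemma pair_circuit_mono: "pair_circuit k U \<Longrightarrow> k \<le> l \<Longrightarrow> pair_circuit l U"
proof (induction arbitrary: l rule: pair_circuit.induct)
  case (pair_circuit_first k U A)
  then show ?case by (cases l) (auto intro: pair_circuit.intros)
next
  case (pair_circuit_second k U A)
  then show ?case by (cases l) (auto intro: pair_circuit.intros)
next
  case (pair_circuit_cz k U)
  then show ?case by (cases l) (auto intro: pair_circuit.intros)
qed (auto intro: pair_circuit.intros)

lemma pair_circuit_mult:
  assumes "pair_circuit k U" "pair_circuit l V"
  shows "pair_circuit (k + l) (U * V)"
  using assms(1)
proof (induction rule: pair_circuit.induct)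
  case (pair_circuit_one k)
  then show ?case using assms(2) pair_circuit_carrier[OF assms(2)] by (auto intro: pair_circuit_mono)
qed (use pair_circuit_carrier[OF assms(2)] pair_circuit_carrier in
      \<open>auto simp: square_mult_assoc[of _ 4] mult_smult_assoc_mat[of _ 4 4 _ 4] intro: pair_circuit.intros\<close>)

lemma pair_circuit_first_qubit: "unitary_mat 2 A \<Longrightarrow> pair_circuit (Suc k) (kron2 A (1\<^sub>m 2))"
  using pair_circuit_first[OF pair_circuit_one[of k]] by simp

lemma pair_circuit_second_qubit: "unitary_mat 2 A \<Longrightarrow> pair_circuit (Suc k) (kron2 (1\<^sub>m 2) A)"
  using pair_circuit_second[OF pair_circuit_one[of k]] by simp

lemma pair_circuit_controlled_z: "pair_circuit (Suc k) controlled_z"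
  using pair_circuit_cz[OF pair_circuit_one[of k]] by simp

lemma pair_circuit_mult_Suc: "pair_circuit (Suc 0) U \<Longrightarrow> pair_circuit k V \<Longrightarrow> pair_circuit (Suc k) (U * V)"
  using pair_circuit_mult[of "Suc 0" U k V] by simp

lemmas pair_circuit_intros = pair_circuit_mult_Suc pair_circuit_first_qubit pair_circuit_second_qubit
  pair_circuit_controlled_z hadamard_unitary z_rotation_unitary x_rotation_unitary

text \<open>\<open>C\<close> is a common price for all gates on the pair; \<open>12 * n\<close> is
  the price of a one-qubit gate.\<close>

lemma reachable_pair_circuit:
  assumes ij: "i \<in> {1..n}" "j \<in> {1..n}" "i \<noteq> j"
    and cz: "reachable n C (on_qubits n [i, j] controlled_z)" and C: "12 * n \<le> C"
    and U: "pair_circuit k U"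
  shows "reachable n (k * C) (on_qubits n [i, j] U)"
  using U
proof (induction rule: pair_circuit.induct)
  case (pair_circuit_one k)
  then show ?case by (simp add: on_qubits_one_2 reachable_one)
next
  case (pair_circuit_first k U A)
  have "reachable n C (on_qubits n [i, j] (kron2 A (1\<^sub>m 2)))"
    using reachable_mono[OF reachable_one_qubit[OF ij(1) pair_circuit_first(2)] C] on_qubits_first[OF ij] by simp
  then have "reachable n (Suc k * C) (on_qubits n [i, j] (kron2 A (1\<^sub>m 2)) * on_qubits n [i, j] U)"
    by (rule reachable_mult[OF _ pair_circuit_first.IH]) simp
  then show ?case using ij pair_circuit_carrier[OF pair_circuit_first(1)] by (simp add: on_qubits_mult_2)
next
  case (pair_circuit_second k U A)
  have "reachable n C (on_qubits n [i, j] (kron2 (1\<^sub>m 2) A))"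
    using reachable_mono[OF reachable_one_qubit[OF ij(2) pair_circuit_second(2)] C] on_qubits_second[OF ij] by simp
  then have "reachable n (Suc k * C) (on_qubits n [i, j] (kron2 (1\<^sub>m 2) A) * on_qubits n [i, j] U)"
    by (rule reachable_mult[OF _ pair_circuit_second.IH]) simp
  then show ?case using ij pair_circuit_carrier[OF pair_circuit_second(1)] by (simp add: on_qubits_mult_2)
next
  case (pair_circuit_cz k U)
  have "reachable n (Suc k * C) (on_qubits n [i, j] controlled_z * on_qubits n [i, j] U)"
    by (rule reachable_mult[OF cz pair_circuit_cz.IH]) simp
  then show ?case using ij pair_circuit_carrier[OF pair_circuit_cz(1)] by (simp add: on_qubits_mult_2)
next
  case (pair_circuit_phase k U w)
  then show ?case using pair_circuit_carrier[OF pair_circuit_phase(1)]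
    by (subst on_qubits_smult) (auto intro: reachable_smult)
qed

text \<open>A rotation conjugated by the gate contains the gate twice; at angle
  \<open>pi / 4\<close> Hadamard gates and Z rotations convert it into the gate itself.\<close>

lemma reachable_adjacent_controlled_z:
  assumes n: "even n" and j: "1 \<le> j" "j < n"
  shows "reachable n (64 * n ^ 2) (on_qubits n [j, Suc j] controlled_z)"
proof -
  let ?q = "on_qubits n [j, Suc j]" and ?H = "on_qubits n [j] hadamard" and ?z = "z_rotation (- pi / 4)"
  let ?M = "?q controlled_z * (on_qubits n [j] (x_rotation (pi / 4)) * ?q controlled_z)"
  have jn: "j \<in> {1..n}" "Suc j \<in> {1..n}" "j \<noteq> Suc j" using j by auto
  have H: "reachable n (12 * n) ?H" by (rule reachable_one_qubit[OF jn(1) hadamard_unitary])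
  have "n \<ge> 2" using j by linarith
  then have "2 * n \<le> n ^ 2" by (simp add: power2_eq_square)
  then have le: "32 * n \<le> 32 * n ^ 2" by linarith
  have "?H * ?M * ?H = ?q (kron2 hadamard (1\<^sub>m 2) * (controlled_z * (kron2 (x_rotation (pi / 4)) (1\<^sub>m 2) * controlled_z)) * kron2 hadamard (1\<^sub>m 2))"
    unfolding on_qubits_first[OF jn] using jn by (simp add: on_qubits_mult_2)
  also have "\<dots> = ?q (zz_rotation (pi / 4))"
    by (simp add: zz_rotation_eq square_mult_assoc[of _ 4])
  finally have zz: "?H * ?M * ?H = ?q (zz_rotation (pi / 4))" .
  have "reachable n (32 * n ^ 2) ?M" by (rule reachable_conj_x_rotation[OF assms])
  then have "reachable n (12 * n + 32 * n ^ 2) (?H * ?M)" by (rule reachable_mult[OF H]) simp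
  then have "reachable n (24 * n + 32 * n ^ 2) (?H * ?M * ?H)" by (rule reachable_mult[OF _ H]) simp
  moreover have "reachable n (8 * n) (on_qubits n [j] ?z * on_qubits n [Suc j] ?z)"
    by (rule reachable_mult[OF reachable_z_rotation[OF jn(1)] reachable_z_rotation[OF jn(2)]]) simp
  \<comment> \<open>The linear terms sum to \<open>32 * n\<close> and are absorbed by another
    \<open>32 * n ^ 2\<close>.\<close>
  ultimately have "reachable n (64 * n ^ 2) (?H * ?M * ?H * (on_qubits n [j] ?z * on_qubits n [Suc j] ?z))"
    by (rule reachable_mult) (use le in simp)
  also have "?H * ?M * ?H * (on_qubits n [j] ?z * on_qubits n [Suc j] ?z) = ?q (zz_rotation (pi / 4) * kron2 ?z ?z)"
    unfolding zz on_qubits_kron2[OF jn, symmetric] using jn by (simp add: on_qubits_mult_2)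
  finally show ?thesis
    by (subst controlled_z_eq_zz_rotation, subst on_qubits_smult) (auto intro: reachable_smult)
qed

section \<open>Transport of controlled-Z gates to distant pairs\<close>

definition swap_mat :: "complex mat" where
  "swap_mat = mat 4 4 (\<lambda>(r, c). of_bool ((r, c) \<in> {(0, 0), (1, 2), (2, 1), (3, 3)}))"

definition cnot_down :: "complex mat" where
  "cnot_down = mat 4 4 (\<lambda>(r, c). of_bool ((r, c) \<in> {(0, 0), (1, 1), (3, 2), (2, 3)}))"

lemma swap_carrier [simp]:
  "swap_mat \<in> carrier_mat 4 4" "cnot_down \<in> carrier_mat 4 4" "cnot_up \<in> carrier_mat 4 4"
  by (simp_all add: swap_mat_def cnot_down_def cnot_up_def)

lemma hadamard_controlled_z_second:
  "kron2 (1\<^sub>m 2) hadamard * controlled_z * kron2 (1\<^sub>m 2) hadamard = cnot_down"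
  by (rule eq_mat_4I)
     (auto simp: mult_mat_index_4 kron2_index controlled_z_index cnot_down_def half_sqrt_2
       simp del: index_mult_mat of_real_divide)

lemma swap_mat_eq: "swap_mat = cnot_down * (cnot_up * cnot_down)"
  by (rule eq_mat_4I)
     (auto simp: mult_mat_index_4 cnot_down_def cnot_up_def swap_mat_def simp del: index_mult_mat)

lemma swap_mat_square: "swap_mat * swap_mat = 1\<^sub>m 4"
  by (rule eq_mat_4I) (auto simp: mult_mat_index_4 swap_mat_def simp del: index_mult_mat)

text \<open>Three CNOT gates, each a controlled-Z gate between two Hadamard gates.\<close>

lemma pair_circuit_swap: "pair_circuit 9 swap_mat"
proof -
  have "pair_circuit 3 cnot_up" "pair_circuit 3 cnot_down"
    unfolding hadamard_controlled_z[symmetric] hadamard_controlled_z_second[symmetric] numeral_3_eq_3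
    by (simp_all only: square_mult_assoc[of _ 4] kron2_carrier controlled_z_carrier, (rule pair_circuit_intros | simp)+)
  then show ?thesis unfolding swap_mat_eq
    using pair_circuit_mult[OF _ pair_circuit_mult] by fastforce
qed

text \<open>At a nonzero entry of the swap, \<open>x\<close> carries on qubit \<open>k\<close> the
  bit that \<open>y\<close> carries on qubit \<open>j\<close>, and both agree on qubit
  \<open>i\<close>. The diagonal signs of the two controlled-Z gates therefore coincide
  there.\<close>

lemma controlled_z_swap:
  assumes "i \<in> {1..n}" "j \<in> {1..n}" "k \<in> {1..n}" "i \<noteq> j" "i \<noteq> k" "j \<noteq> k"
  shows "on_qubits n [i, k] controlled_z =
    on_qubits n [j, k] swap_mat * (on_qubits n [i, j] controlled_z * on_qubits n [j, k] swap_mat)"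
proof -
  let ?d = "2 ^ n :: nat"
  let ?S = "on_qubits n [j, k] swap_mat"
  have v: "qubit_val n x q = 0 \<or> qubit_val n x q = 1" for x q by (simp add: qubit_val_def)
  have "on_qubits n [i, k] controlled_z * ?S = ?S * on_qubits n [i, j] controlled_z"
  proof (rule eq_matI)
    fix x y assume "x < dim_row (?S * on_qubits n [i, j] controlled_z)" "y < dim_col (?S * on_qubits n [i, j] controlled_z)"
    then have x: "x < ?d" and y: "y < ?d" by auto
    have cz: "on_qubits n [p, q] controlled_z $$ (z, z) = (if qubit_val n z p = 1 \<and> qubit_val n z q = 1 then - 1 else 1)"
      if "z < ?d" for p q z
      using that v[of z p] v[of z q] by (auto simp: on_qubits_index sub_index_2 controlled_z_index)
    have "(on_qubits n [i, k] controlled_z * ?S) $$ (x, y) = on_qubits n [i, k] controlled_z $$ (x, x) * ?S $$ (x, y)"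
      by (rule diagonal_mult_index[OF _ on_qubits_controlled_z_diagonal _ x y]) simp_all
    also have "\<dots> = ?S $$ (x, y) * on_qubits n [i, j] controlled_z $$ (y, y)"
    proof (cases "?S $$ (x, y) = 0")
      case False
      then have agree: "\<forall>q \<in> {1..n} - set [j, k]. qubit_val n x q = qubit_val n y q"
        using on_qubits_index_eq_0[OF x y] by blast
      have "swap_mat $$ (sub_index n [j, k] x, sub_index n [j, k] y) \<noteq> 0"
        using False unfolding on_qubits_index_agree[OF x y agree] .
      then have "qubit_val n x k = qubit_val n y j"
        using v[of x j] v[of x k] v[of y j] v[of y k] by (auto simp: sub_index_2 swap_mat_def)
      moreover have "qubit_val n x i = qubit_val n y i" using agree assms by simp
      ultimately show ?thesis using x y by (simp add: cz)
    qed simp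
    also have "\<dots> = (?S * on_qubits n [i, j] controlled_z) $$ (x, y)"
      by (rule mult_diagonal_index[OF _ on_qubits_controlled_z_diagonal _ x y, symmetric]) simp_all
    finally show "(on_qubits n [i, k] controlled_z * ?S) $$ (x, y) = (?S * on_qubits n [i, j] controlled_z) $$ (x, y)" .
  qed auto
  then have "on_qubits n [i, k] controlled_z * (?S * ?S) = ?S * (on_qubits n [i, j] controlled_z * ?S)"
    by (intro mult_swap_mat[where d = ?d]) simp_all
  moreover have "?S * ?S = 1\<^sub>m ?d" using assms by (simp add: on_qubits_mult_2 swap_mat_square on_qubits_one_2)
  ultimately show ?thesis by simp
qed

text \<open>Each further step of distance conjugates with a swap of neighbours, at a price of
  \<open>2 * 9 * 64 * n ^ 2 = 1152 * n ^ 2\<close>.\<close>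

lemma reachable_controlled_z_less:
  assumes n: "even n" and ij: "1 \<le> i" "i + Suc k \<le> n"
  shows "reachable n (1152 * n ^ 2 * Suc k) (on_qubits n [i, i + Suc k] controlled_z)"
  using ij(2)
proof (induction k)
  case 0
  have "reachable n (64 * n ^ 2) (on_qubits n [i, Suc i] controlled_z)"
    by (rule reachable_adjacent_controlled_z) (use n ij in auto)
  then have "reachable n (1152 * n ^ 2) (on_qubits n [i, Suc i] controlled_z)" by (rule reachable_mono) simp
  then show ?case by simp
next
  case (Suc k)
  let ?j = "i + Suc k"
  have jn: "?j \<in> {1..n}" "Suc ?j \<in> {1..n}" "?j \<noteq> Suc ?j" using Suc.prems by auto
  have "reachable n (64 * n ^ 2) (on_qubits n [?j, Suc ?j] controlled_z)"
    by (rule reachable_adjacent_controlled_z) (use n Suc.prems in auto)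
  then have "reachable n (9 * (64 * n ^ 2)) (on_qubits n [?j, Suc ?j] swap_mat)"
    by (rule reachable_pair_circuit[OF jn _ _ pair_circuit_swap]) (simp add: power2_eq_square)
  then have S: "reachable n (576 * n ^ 2) (on_qubits n [?j, Suc ?j] swap_mat)" by simp
  have "reachable n (1152 * n ^ 2 * Suc k) (on_qubits n [i, ?j] controlled_z)" using Suc by simp
  then have "reachable n (1152 * n ^ 2 * Suc k + 576 * n ^ 2) (on_qubits n [i, ?j] controlled_z * on_qubits n [?j, Suc ?j] swap_mat)"
    by (rule reachable_mult[OF _ S]) simp
  then have "reachable n (1152 * n ^ 2 * Suc (Suc k))
     (on_qubits n [?j, Suc ?j] swap_mat * (on_qubits n [i, ?j] controlled_z * on_qubits n [?j, Suc ?j] swap_mat))"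
    by (rule reachable_mult[OF S]) simp
  also have "on_qubits n [?j, Suc ?j] swap_mat * (on_qubits n [i, ?j] controlled_z * on_qubits n [?j, Suc ?j] swap_mat)
      = on_qubits n [i, i + Suc (Suc k)] controlled_z"
    using controlled_z_swap[of i n ?j "Suc ?j"] ij Suc.prems by simp
  finally show ?case .
qed

lemma controlled_z_symmetric: "on_qubits n [j, i] controlled_z = on_qubits n [i, j] controlled_z"
proof (rule eq_matI)
  fix x y assume "x < dim_row (on_qubits n [i, j] controlled_z)" "y < dim_col (on_qubits n [i, j] controlled_z)"
  then have x: "x < 2 ^ n" and y: "y < 2 ^ n" by auto
  have v: "qubit_val n x q = 0 \<or> qubit_val n x q = 1" for x q by (simp add: qubit_val_def)
  have "controlled_z $$ (sub_index n [j, i] x, sub_index n [j, i] y) = controlled_z $$ (sub_index n [i, j] x, sub_index n [i, j] y)"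
    using v[of x i] v[of x j] v[of y i] v[of y j] by (auto simp: sub_index_2 controlled_z_index)
  moreover have "set [j, i] = set [i, j]" by auto
  ultimately show "on_qubits n [j, i] controlled_z $$ (x, y) = on_qubits n [i, j] controlled_z $$ (x, y)"
    unfolding on_qubits_index[OF x y] by presburger
qed auto

lemma reachable_controlled_z:
  assumes n: "even n" and ij: "i \<in> {1..n}" "j \<in> {1..n}" "i \<noteq> j"
  shows "reachable n (1152 * n ^ 3) (on_qubits n [i, j] controlled_z)"
proof -
  have *: "reachable n (1152 * n ^ 3) (on_qubits n [p, q] controlled_z)" if pq: "1 \<le> p" "p < q" "q \<le> n" for p q
  proof -
    obtain k where k: "q = p + Suc k" using less_imp_Suc_add[OF pq(2)] by auto
    have "reachable n (1152 * n ^ 2 * Suc k) (on_qubits n [p, p + Suc k] controlled_z)"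
      by (rule reachable_controlled_z_less) (use n pq k in auto)
    moreover have "1152 * n ^ 2 * Suc k \<le> 1152 * n ^ 2 * n" by (rule mult_le_mono2) (use pq k in simp)
    ultimately show ?thesis unfolding k by (rule reachable_mono[OF _ order_trans]) (simp add: power_numeral_reduce)
  qed
  show ?thesis
  proof (cases "i < j")
    case True
    then show ?thesis using * ij by simp
  next
    case False
    then show ?thesis using *[of j i] ij controlled_z_symmetric[of n j i] by simp
  qed
qed

subsection \<open>Two-qubit gates\<close>

text \<open>A complex Givens rotation in the plane of the basis states \<open>p\<close> and
  \<open>q\<close>.\<close>

definition two_level :: "nat \<Rightarrow> nat \<Rightarrow> real \<Rightarrow> complex \<Rightarrow> complex mat" where
  "two_level p q c s = mat 4 4 (\<lambda>(i, j).
     if i = p \<and> j = p \<or> i = q \<and> j = q then complex_of_real c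
     else if i = p \<and> j = q then - cnj s else if i = q \<and> j = p then s else of_bool (i = j))"

lemma two_level_carrier [simp]: "two_level p q c s \<in> carrier_mat 4 4"
  by (simp add: two_level_def)

lemma two_level_index:
  "i < 4 \<Longrightarrow> j < 4 \<Longrightarrow> two_level p q c s $$ (i, j) =
    (if i = p \<and> j = p \<or> i = q \<and> j = q then complex_of_real c
     else if i = p \<and> j = q then - cnj s else if i = q \<and> j = p then s else of_bool (i = j))"
  by (simp add: two_level_def)

text \<open>The edges are oriented: the second component is the row in which an entry gets cleared,
  the first its pivot row.\<close>

abbreviation gray_edges :: "(nat \<times> nat) set" where
  "gray_edges \<equiv> {(0, 1), (1, 3), (3, 2)}"

lemma two_level_mult_index:
  assumes pq: "(p, q) \<in> gray_edges" and U: "U \<in> carrier_mat 4 4" and "i < 4" "j < 4"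
  shows "(two_level p q c s * U) $$ (i, j) =
    (if i = p then complex_of_real c * U $$ (p, j) - cnj s * U $$ (q, j)
     else if i = q then s * U $$ (p, j) + complex_of_real c * U $$ (q, j) else U $$ (i, j))"
proof -
  have "i \<in> {0, 1, 2, 3}" using \<open>i < 4\<close> by auto
  then show ?thesis
    unfolding mult_mat_index_4[OF two_level_carrier U \<open>i < 4\<close> \<open>j < 4\<close>]
    using pq by (elim insertE emptyE) (simp_all add: two_level_index)
qed

lemma two_level_inverse:
  assumes pq: "(p, q) \<in> gray_edges" and cs: "c\<^sup>2 + (cmod s)\<^sup>2 = 1"
  shows "two_level p q c s * two_level p q c (- s) = 1\<^sub>m 4"
proof -
  have *: "complex_of_real c * complex_of_real c + s * cnj s = 1"
    using cs by (metis complex_norm_square of_real_1 of_real_add power2_eq_square of_real_mult)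
  then have "complex_of_real c * complex_of_real c + cnj s * s = 1" by (simp add: mult.commute)
  note facts = * this trans[OF add.commute *]
  show ?thesis
    by (rule eq_mat_4I; use pq in \<open>auto simp: two_level_mult_index two_level_index facts mult.commute[of c] simp del: index_mult_mat\<close>)
qed

lemma two_level_unitary:
  assumes pq: "(p, q) \<in> gray_edges" and cs: "c\<^sup>2 + (cmod s)\<^sup>2 = 1"
  shows "unitary_mat 4 (two_level p q c s)"
proof -
  have "mat_adjoint (two_level p q c s) = two_level p q c (- s)"
    by (rule eq_mat_4I)
       (use pq in \<open>auto simp: mat_adjoint_index[OF two_level_carrier] two_level_index\<close>)
  then show ?thesis
    using two_level_inverse[OF pq cs] two_level_inverse[OF pq, of c "- s"] cs
    by (simp add: unitary_mat_def)
qed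

text \<open>For the 2 by 2 Givens rotation \<open>G\<close>, both \<open>Z\<close> and
  \<open>G Z\<close> are Hermitian involutions. The matrix \<open>R\<close> defined here is their
  normalized sum, the reflection that exchanges them, so \<open>R Z R Z = G\<close>.\<close>

definition reflection :: "real \<Rightarrow> complex \<Rightarrow> complex mat" where
  "reflection c s = complex_of_real (1 / sqrt (2 + 2 * c)) \<cdot>\<^sub>m
     mat 2 2 (\<lambda>(i, j). if i = j then if i = 0 then 1 + c else - (1 + c) else if i = 0 then cnj s else s)"

lemma reflection_carrier [simp]: "reflection c s \<in> carrier_mat 2 2"
  by (simp add: reflection_def)

context
  fixes c :: real and s :: complex
  assumes c: "0 \<le> c" and cs: "c\<^sup>2 + (cmod s)\<^sup>2 = 1"
begin

text \<open>The square root in the normalization disappears from the products of two entries that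
  occur in \<open>R R\<close> and \<open>R Z R Z\<close>, since
  \<open>k * k * (1 + c) = 1 / 2\<close> and \<open>s * cnj s = (1 - c) * (1 + c)\<close>.\<close>

lemma reflection_prod_index:
  "reflection c s $$ (0, 0) * reflection c s $$ (0, 0) = (1 + c) / 2"
  "reflection c s $$ (Suc 0, Suc 0) * reflection c s $$ (Suc 0, Suc 0) = (1 + c) / 2"
  "reflection c s $$ (0, Suc 0) * reflection c s $$ (Suc 0, 0) = (1 - c) / 2"
  "reflection c s $$ (Suc 0, 0) * reflection c s $$ (0, Suc 0) = (1 - c) / 2"
  "reflection c s $$ (0, 0) * reflection c s $$ (0, Suc 0) = cnj s / 2"
  "reflection c s $$ (0, Suc 0) * reflection c s $$ (Suc 0, Suc 0) = - cnj s / 2"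
  "reflection c s $$ (Suc 0, 0) * reflection c s $$ (0, 0) = s / 2"
  "reflection c s $$ (Suc 0, Suc 0) * reflection c s $$ (Suc 0, 0) = - s / 2"
proof -
  define k where "k = complex_of_real (1 / sqrt (2 + 2 * c))"
  have k2: "k * k = complex_of_real (1 / (2 * (1 + c)))"
  proof -
    have "1 / sqrt (2 + 2 * c) * (1 / sqrt (2 + 2 * c)) = 1 / (2 * (1 + c))" using c by simp
    then show ?thesis unfolding k_def of_real_mult[symmetric] by (rule arg_cong)
  qed
  have ne: "1 + complex_of_real c \<noteq> 0" using c by (metis add_nonneg_eq_0_iff of_real_1 of_real_add of_real_eq_0_iff zero_le_one zero_neq_one)
  have k1: "k * k * (1 + complex_of_real c) = 1 / 2"
  proof -
    have "1 / (2 * d) * d = 1 / 2" if "d \<noteq> 0" for d :: complex using that by simp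
    from this[OF ne] show ?thesis unfolding k2 by simp
  qed
  have ss: "s * cnj s = (1 - complex_of_real c) * (1 + complex_of_real c)"
  proof -
    have "(cmod s)\<^sup>2 = 1 - c\<^sup>2" using cs by simp
    then have "s * cnj s = complex_of_real (1 - c\<^sup>2)" unfolding complex_norm_square[symmetric] by (rule arg_cong)
    then show ?thesis by (simp add: algebra_simps power2_eq_square)
  qed
  have e: "reflection c s $$ (0, 0) = k * (1 + c)" "reflection c s $$ (0, Suc 0) = k * cnj s"
    "reflection c s $$ (Suc 0, 0) = k * s" "reflection c s $$ (Suc 0, Suc 0) = - (k * (1 + c))"
    by (simp_all add: reflection_def k_def) (simp add: diff_divide_distrib add_divide_distrib)
  have a: "(k * (1 + complex_of_real c)) * (k * z) = z / 2" "(k * z) * (k * (1 + complex_of_real c)) = z / 2" for z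
    using k1 by (metis (no_types, opaque_lifting) mult.assoc mult.commute mult_1 times_divide_eq_left)+
  have b: "(k * cnj s) * (k * s) = (1 - complex_of_real c) / 2" "(k * s) * (k * cnj s) = (1 - complex_of_real c) / 2"
  proof -
    have "(k * s) * (k * cnj s) = k * k * (s * cnj s)" by (simp add: ac_simps)
    also have "\<dots> = (1 - complex_of_real c) * (k * k * (1 + complex_of_real c))" unfolding ss by (simp add: ac_simps)
    finally show "(k * s) * (k * cnj s) = (1 - complex_of_real c) / 2" unfolding k1 by simp
    then show "(k * cnj s) * (k * s) = (1 - complex_of_real c) / 2" by (simp add: ac_simps)
  qed
  show "reflection c s $$ (0, 0) * reflection c s $$ (0, 0) = (1 + c) / 2"
    "reflection c s $$ (Suc 0, Suc 0) * reflection c s $$ (Suc 0, Suc 0) = (1 + c) / 2"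
    "reflection c s $$ (0, Suc 0) * reflection c s $$ (Suc 0, 0) = (1 - c) / 2"
    "reflection c s $$ (Suc 0, 0) * reflection c s $$ (0, Suc 0) = (1 - c) / 2"
    "reflection c s $$ (0, 0) * reflection c s $$ (0, Suc 0) = cnj s / 2"
    "reflection c s $$ (0, Suc 0) * reflection c s $$ (Suc 0, Suc 0) = - cnj s / 2"
    "reflection c s $$ (Suc 0, 0) * reflection c s $$ (0, 0) = s / 2"
    "reflection c s $$ (Suc 0, Suc 0) * reflection c s $$ (Suc 0, 0) = - s / 2"
    unfolding e of_real_add of_real_1 mult_minus_left mult_minus_right minus_minus a b
    by (simp_all del: mult_minus_left)
qed

lemma reflection_unitary: "unitary_mat 2 (reflection c s)"
proof (rule hermitian_involution_unitary)
  show "reflection c s * reflection c s = 1\<^sub>m 2"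
    by (rule eq_mat_2I)
       (simp_all add: mult_mat_index_2 reflection_prod_index del: index_mult_mat, simp_all add: field_simps)
  show "cnj (reflection c s $$ (j, i)) = reflection c s $$ (i, j)" if "i < 2" "j < 2" for i j
    using that by (auto simp: reflection_def less_2_iff)
qed simp

text \<open>If the first qubit is 0, the controlled-Z gates are inactive and the two reflections
  cancel; if it is 1, they act as \<open>Z\<close> and \<open>R Z R Z\<close> is the Givens
  rotation. The next lemma exchanges the roles of the qubits.\<close>

lemma two_level_2_3:
  "kron2 (1\<^sub>m 2) (reflection c s) * (controlled_z * (kron2 (1\<^sub>m 2) (reflection c s) * controlled_z)) =
    two_level 2 3 c s"
  by (rule eq_mat_4I)
     (auto simp: mult_mat_index_4 kron2_index controlled_z_index two_level_index reflection_prod_index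
       simp del: index_mult_mat, simp_all add: field_simps)

lemma two_level_1_3:
  "kron2 (reflection c s) (1\<^sub>m 2) * (controlled_z * (kron2 (reflection c s) (1\<^sub>m 2) * controlled_z)) =
    two_level 1 3 c s"
  by (rule eq_mat_4I)
     (auto simp: mult_mat_index_4 kron2_index controlled_z_index two_level_index reflection_prod_index
       simp del: index_mult_mat, simp_all add: field_simps)

lemma pair_circuit_two_level_2_3: "pair_circuit 4 (two_level 2 3 c s)"
proof -
  have "pair_circuit (Suc (Suc (Suc (Suc 0)))) (two_level 2 3 c s)"
    unfolding two_level_2_3[symmetric] by (rule pair_circuit_intros reflection_unitary)+
  then show ?thesis by (simp add: eval_nat_numeral)
qed

end

text \<open>The X rotations by \<open>pi / 2\<close> and \<open>- pi / 2\<close> are bit flips up to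
  opposite phases; they change the control value of the first qubit from 1 to 0.\<close>

lemma two_level_0_1:
  "kron2 (x_rotation (pi / 2)) (1\<^sub>m 2) * (two_level 2 3 c s * kron2 (x_rotation (- pi / 2)) (1\<^sub>m 2)) =
    two_level 0 1 c s"
proof -
  have *: "\<i> * (z * \<i>) = - z" for z
  proof -
    have "\<i> * (z * \<i>) = (\<i> * \<i>) * z" by (simp only: ac_simps)
    then show ?thesis by simp
  qed
  show ?thesis
    by (rule eq_mat_4I)
       (auto simp: mult_mat_index_4 kron2_index two_level_index * simp del: index_mult_mat)
qed

lemma two_level_3_2: "two_level 2 3 c (- cnj s) = two_level 3 2 c s"
  by (rule eq_mat_4I) (auto simp: two_level_index)

text \<open>The bound 6 is the case of the edge \<open>(0, 1)\<close>: four gates and the two flips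
  of the control.\<close>

lemma pair_circuit_two_level:
  assumes pq: "(p, q) \<in> gray_edges" and c: "0 \<le> c" and cs: "c\<^sup>2 + (cmod s)\<^sup>2 = 1"
  shows "pair_circuit 6 (two_level p q c s)"
proof -
  have 23: "pair_circuit 4 (two_level 2 3 c t)" if "c\<^sup>2 + (cmod t)\<^sup>2 = 1" for t
    by (rule pair_circuit_two_level_2_3[OF c that])
  consider "p = 0" "q = 1" | "p = 1" "q = 3" | "p = 3" "q = 2" using pq by auto
  then show ?thesis
  proof cases
    case 1
    have "pair_circuit (Suc 4) (two_level 2 3 c s * kron2 (x_rotation (- pi / 2)) (1\<^sub>m 2))"
      using pair_circuit_mult[OF 23[OF cs] pair_circuit_first_qubit[OF x_rotation_unitary, of 0]] by simp
    then have "pair_circuit (Suc (Suc 4)) (two_level 0 1 c s)"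
      unfolding two_level_0_1[symmetric] by (rule pair_circuit_mult_Suc[OF pair_circuit_first_qubit[OF x_rotation_unitary]])
    then show ?thesis using 1 by simp
  next
    case 2
    have "pair_circuit (Suc (Suc (Suc (Suc 0)))) (two_level 1 3 c s)"
      unfolding two_level_1_3[OF c cs, symmetric] by (rule pair_circuit_intros reflection_unitary[OF c cs])+
    then show ?thesis using 2 by (auto intro: pair_circuit_mono)
  next
    case 3
    have "pair_circuit 4 (two_level 3 2 c s)" using 23[of "- cnj s"] cs by (simp add: two_level_3_2)
    then show ?thesis using 3 by (auto intro: pair_circuit_mono)
  qed
qed

text \<open>For nonzero \<open>a\<close> the modulus of \<open>a\<close> is divided by the norm of
  the pair, which keeps \<open>c\<close> real and nonnegative; the equation then determines
  \<open>s\<close>.\<close>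

lemma givens_coefficients:
  fixes a b :: complex
  shows "\<exists>c s. 0 \<le> c \<and> c\<^sup>2 + (cmod s)\<^sup>2 = 1 \<and> s * a + complex_of_real c * b = 0"
proof (cases "a = 0")
  case True
  then show ?thesis by (intro exI[of _ 0] exI[of _ 1]) simp
next
  case False
  define r where "r = sqrt ((cmod a)\<^sup>2 + (cmod b)\<^sup>2)"
  have r2: "r\<^sup>2 = (cmod a)\<^sup>2 + (cmod b)\<^sup>2" by (simp add: r_def)
  have "r\<^sup>2 \<noteq> 0" unfolding r2 using False by (simp add: add_nonneg_eq_0_iff)
  then have r: "r \<noteq> 0" by simp
  have r0: "0 \<le> r" by (simp add: r_def)
  let ?c = "cmod a / r" and ?s = "- complex_of_real (cmod a / r) * b / a"
  have "cmod ?s = cmod b / r" using False r r0 by (simp add: norm_mult norm_divide)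
  then have "?c\<^sup>2 + (cmod ?s)\<^sup>2 = ((cmod a)\<^sup>2 + (cmod b)\<^sup>2) / r\<^sup>2"
    by (simp only: power_divide add_divide_distrib)
  also have "\<dots> = 1" using r unfolding r2[symmetric] by simp
  finally have "?c\<^sup>2 + (cmod ?s)\<^sup>2 = 1" .
  then show ?thesis using False r0 by (intro exI[of _ ?c] exI[of _ ?s]) simp
qed

text \<open>The last two conclusions preserve earlier zeros: other rows are untouched, and a column
  that vanishes in both rotated rows keeps vanishing there.\<close>

lemma givens_step:
  assumes U: "unitary_mat 4 U" and pq: "(p, q) \<in> gray_edges" and j: "j < 4"
  obtains V where "unitary_mat 4 V" "V $$ (q, j) = 0" "\<And>k. pair_circuit k V \<Longrightarrow> pair_circuit (6 + k) U"
    "\<And>i k. i < 4 \<Longrightarrow> k < 4 \<Longrightarrow> i \<noteq> p \<Longrightarrow> i \<noteq> q \<Longrightarrow> V $$ (i, k) = U $$ (i, k)"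
    "\<And>k. k < 4 \<Longrightarrow> U $$ (p, k) = 0 \<Longrightarrow> U $$ (q, k) = 0 \<Longrightarrow> V $$ (p, k) = 0 \<and> V $$ (q, k) = 0"
proof -
  obtain c s where cs: "0 \<le> c" "c\<^sup>2 + (cmod s)\<^sup>2 = 1" "s * U $$ (p, j) + complex_of_real c * U $$ (q, j) = 0"
    using givens_coefficients by blast
  define V where "V = two_level p q c s * U"
  have Uc: "U \<in> carrier_mat 4 4" by (rule unitary_mat_carrier[OF U])
  have pq4: "p < 4" "q < 4" "p \<noteq> q" using pq by auto
  have inv: "two_level p q c (- s) * two_level p q c s = 1\<^sub>m 4"
    using two_level_inverse[OF pq, of c "- s"] cs by simp
  have "U = two_level p q c (- s) * V" unfolding V_def
    by (rule mult_cancel_mat[OF _ _ _ inv, symmetric]) (use Uc in simp_all)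
  moreover have "pair_circuit 6 (two_level p q c (- s))"
    by (rule pair_circuit_two_level[OF pq cs(1)]) (use cs in simp)
  ultimately have "pair_circuit (6 + k) U" if "pair_circuit k V" for k
    using pair_circuit_mult[OF _ that] by metis
  moreover have "unitary_mat 4 V" unfolding V_def by (rule unitary_mult[OF two_level_unitary[OF pq cs(2)] U])
  ultimately show thesis
    using that[of V] two_level_mult_index[OF pq Uc] pq4 j cs(3) unfolding V_def by (simp del: index_mult_mat)
qed

text \<open>In the order 0, 1, 3, 2 of the basis the matrix is upper triangular. Column and row
  norms, taken alternately along this order, force a triangular unitary matrix to be
  diagonal.\<close>

lemma unitary_mat_zero_pattern:
  assumes V: "unitary_mat 4 V" and z: "V $$ (1, 0) = 0" "V $$ (2, 0) = 0" "V $$ (3, 0) = 0"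
    "V $$ (3, 1) = 0" "V $$ (2, 1) = 0" "V $$ (2, 3) = 0"
  shows "\<And>i j. i < 4 \<Longrightarrow> j < 4 \<Longrightarrow> i \<noteq> j \<Longrightarrow> V $$ (i, j) = 0" "\<And>i. i < 4 \<Longrightarrow> cmod (V $$ (i, i)) = 1"
proof -
  note col = unitary_col_norm[OF V, unfolded sum_lessThan_4]
  note row = unitary_row_norm[OF V, unfolded sum_lessThan_4]
  have sq: "a = 0 \<and> b = 0 \<and> c = 0" if "(cmod a)\<^sup>2 + (cmod b)\<^sup>2 + (cmod c)\<^sup>2 = 0" for a b c
    using that by (simp add: add_nonneg_eq_0_iff)
  have 0: "(cmod (V $$ (0, 0)))\<^sup>2 = 1" using col[of 0] z by simp
  have r0: "V $$ (0, 1) = 0 \<and> V $$ (0, 2) = 0 \<and> V $$ (0, 3) = 0" by (rule sq) (use row[of 0] 0 in simp)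
  have 1: "(cmod (V $$ (1, 1)))\<^sup>2 = 1" using col[of 1] z r0 by simp
  have r1: "V $$ (1, 0) = 0 \<and> V $$ (1, 2) = 0 \<and> V $$ (1, 3) = 0" by (rule sq) (use row[of 1] 1 in simp)
  have 3: "(cmod (V $$ (3, 3)))\<^sup>2 = 1" using col[of 3] z r0 r1 by simp
  have r3: "V $$ (3, 0) = 0 \<and> V $$ (3, 1) = 0 \<and> V $$ (3, 2) = 0" by (rule sq) (use row[of 3] 3 in simp)
  have 2: "(cmod (V $$ (2, 2)))\<^sup>2 = 1" using col[of 2] r0 r1 r3 by simp
  show "V $$ (i, j) = 0" if "i < 4" "j < 4" "i \<noteq> j" for i j
  proof -
    have "i \<in> {0, 1, 2, 3}" "j \<in> {0, 1, 2, 3}" using that by auto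
    then show ?thesis using that(3) z r0 r1 r3 by (elim insertE emptyE) simp_all
  qed
  show "cmod (V $$ (i, i)) = 1" if "i < 4" for i
  proof -
    have "i \<in> {0, 1, 2, 3}" using that by auto
    then show ?thesis using 0 1 2 3 by (elim insertE emptyE) (simp_all add: cmod_eq_1I)
  qed
qed

lemma pair_circuit_zz_rotation: "pair_circuit 5 (zz_rotation a)"
proof -
  have "pair_circuit (Suc (Suc (Suc (Suc (Suc 0))))) (zz_rotation a)"
    unfolding zz_rotation_eq by (rule pair_circuit_intros)+
  then show ?thesis by (simp add: eval_nat_numeral)
qed

text \<open>Every real function of two bits is a combination of 1, \<open>Z\<close> on either qubit
  and \<open>Z Z\<close>. Applied to the four phases this gives a global phase, two Z rotations and
  a ZZ rotation of five gates.\<close>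

lemma pair_circuit_diagonal:
  assumes V: "V \<in> carrier_mat 4 4" and off: "\<And>i j. i < 4 \<Longrightarrow> j < 4 \<Longrightarrow> i \<noteq> j \<Longrightarrow> V $$ (i, j) = 0"
    and on: "\<And>i. i < 4 \<Longrightarrow> cmod (V $$ (i, i)) = 1"
  shows "pair_circuit 7 V"
proof -
  define t where "t i = Arg (V $$ (i, i))" for i
  have V_cis: "V $$ (i, i) = cis (t i)" if "i < 4" for i
    using rcis_cmod_Arg[of "V $$ (i, i)"] on[OF that] by (simp add: rcis_def t_def)
  \<comment> \<open>The Walsh-Hadamard coefficients of the four phases.\<close>
  define f a b c where "f = (t 0 + t 1 + t 2 + t 3) / 4" and "a = (t 0 + t 1 - t 2 - t 3) / 4"
    and "b = (t 0 - t 1 + t 2 - t 3) / 4" and "c = (t 0 - t 1 - t 2 + t 3) / 4"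
  have t: "t 0 = f + a + b + c" "t 1 = f + a - b - c" "t 2 = f - a + b - c" "t 3 = f - a - b + c"
    unfolding f_def a_def b_def c_def by (simp_all add: field_simps)
  have V_eq: "V = cis f \<cdot>\<^sub>m (kron2 (z_rotation a) (1\<^sub>m 2) * (kron2 (1\<^sub>m 2) (z_rotation b) * zz_rotation c))"
  proof (rule eq_mat_4I[OF V])
    fix i j :: nat assume "i \<in> {0, 1, 2, 3}" "j \<in> {0, 1, 2, 3}"
    then show "V $$ (i, j) = (cis f \<cdot>\<^sub>m (kron2 (z_rotation a) (1\<^sub>m 2) * (kron2 (1\<^sub>m 2) (z_rotation b) * zz_rotation c))) $$ (i, j)"
      by (elim insertE emptyE)
         (simp_all add: off V_cis[of 0, simplified] V_cis[of 1, simplified] V_cis[of 2, simplified] V_cis[of 3, simplified]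
           t[simplified] mult_mat_index_4 kron2_index zz_rotation_def cis_mult algebra_simps del: index_mult_mat(1))
  qed simp
  have "pair_circuit (Suc (Suc 5)) (kron2 (z_rotation a) (1\<^sub>m 2) * (kron2 (1\<^sub>m 2) (z_rotation b) * zz_rotation c))"
    by (rule pair_circuit_intros pair_circuit_zz_rotation)+
  then show ?thesis unfolding V_eq by (intro pair_circuit_phase) simp_all
qed

text \<open>
  Along the path 0, 1, 3, 2 consecutive basis states differ in one qubit, so each Givens rotation
  of neighbouring rows is a controlled one-qubit gate.
\<close>

lemma pair_circuit_unitary:
  assumes U: "unitary_mat 4 U"
  shows "pair_circuit 43 U"
proof -
  \<comment> \<open>Elimination runs backwards along the path, so each pivot row is still free in
    the current column: rows 2, 3, 1 of column 0, then rows 2, 3 of column 1, then row 2 of column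
    3.\<close>
  obtain A where A: "unitary_mat 4 A" "A $$ (2, 0) = 0" "\<And>k. pair_circuit k A \<Longrightarrow> pair_circuit (6 + k) U"
    by (rule givens_step[OF U, of 3 2 0]) (simp, simp, rule that)
  obtain B where B: "unitary_mat 4 B" "B $$ (3, 0) = 0" "\<And>k. pair_circuit k B \<Longrightarrow> pair_circuit (6 + k) A"
    "\<And>i k. i < 4 \<Longrightarrow> k < 4 \<Longrightarrow> i \<noteq> 1 \<Longrightarrow> i \<noteq> 3 \<Longrightarrow> B $$ (i, k) = A $$ (i, k)"
    by (rule givens_step[OF A(1), of 1 3 0]) (simp, simp, rule that)
  obtain C where C: "unitary_mat 4 C" "C $$ (1, 0) = 0" "\<And>k. pair_circuit k C \<Longrightarrow> pair_circuit (6 + k) B"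
    "\<And>i k. i < 4 \<Longrightarrow> k < 4 \<Longrightarrow> i \<noteq> 0 \<Longrightarrow> i \<noteq> 1 \<Longrightarrow> C $$ (i, k) = B $$ (i, k)"
    by (rule givens_step[OF B(1), of 0 1 0]) (simp, simp, rule that)
  have zC: "C $$ (1, 0) = 0" "C $$ (2, 0) = 0" "C $$ (3, 0) = 0"
    using A(2) B(2) B(4)[of 2 0] C(2) C(4)[of 2 0] C(4)[of 3 0] by simp_all
  obtain D where D: "unitary_mat 4 D" "D $$ (2, 1) = 0" "\<And>k. pair_circuit k D \<Longrightarrow> pair_circuit (6 + k) C"
    "\<And>i k. i < 4 \<Longrightarrow> k < 4 \<Longrightarrow> i \<noteq> 3 \<Longrightarrow> i \<noteq> 2 \<Longrightarrow> D $$ (i, k) = C $$ (i, k)"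
    "\<And>k. k < 4 \<Longrightarrow> C $$ (3, k) = 0 \<Longrightarrow> C $$ (2, k) = 0 \<Longrightarrow> D $$ (3, k) = 0 \<and> D $$ (2, k) = 0"
    by (rule givens_step[OF C(1), of 3 2 1]) (simp, simp, rule that)
  \<comment> \<open>Column 0 already vanishes in both rotated rows, so its zeros survive.\<close>
  have zD: "D $$ (1, 0) = 0" "D $$ (2, 0) = 0" "D $$ (3, 0) = 0" "D $$ (2, 1) = 0"
    using zC D(2) D(4)[of 1 0] D(5)[of 0] by simp_all
  obtain E where E: "unitary_mat 4 E" "E $$ (3, 1) = 0" "\<And>k. pair_circuit k E \<Longrightarrow> pair_circuit (6 + k) D"
    "\<And>i k. i < 4 \<Longrightarrow> k < 4 \<Longrightarrow> i \<noteq> 1 \<Longrightarrow> i \<noteq> 3 \<Longrightarrow> E $$ (i, k) = D $$ (i, k)"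
    "\<And>k. k < 4 \<Longrightarrow> D $$ (1, k) = 0 \<Longrightarrow> D $$ (3, k) = 0 \<Longrightarrow> E $$ (1, k) = 0 \<and> E $$ (3, k) = 0"
    by (rule givens_step[OF D(1), of 1 3 1]) (simp, simp, rule that)
  have zE: "E $$ (1, 0) = 0" "E $$ (2, 0) = 0" "E $$ (3, 0) = 0" "E $$ (2, 1) = 0" "E $$ (3, 1) = 0"
    using zD E(2) E(4)[of 2 0] E(4)[of 2 1] E(5)[of 0] by simp_all
  obtain V where V: "unitary_mat 4 V" "V $$ (2, 3) = 0" "\<And>k. pair_circuit k V \<Longrightarrow> pair_circuit (6 + k) E"
    "\<And>i k. i < 4 \<Longrightarrow> k < 4 \<Longrightarrow> i \<noteq> 3 \<Longrightarrow> i \<noteq> 2 \<Longrightarrow> V $$ (i, k) = E $$ (i, k)"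
    "\<And>k. k < 4 \<Longrightarrow> E $$ (3, k) = 0 \<Longrightarrow> E $$ (2, k) = 0 \<Longrightarrow> V $$ (3, k) = 0 \<and> V $$ (2, k) = 0"
    by (rule givens_step[OF E(1), of 3 2 3]) (simp, simp, rule that)
  have zV: "V $$ (1, 0) = 0" "V $$ (2, 0) = 0" "V $$ (3, 0) = 0" "V $$ (3, 1) = 0" "V $$ (2, 1) = 0"
    using zE V(4)[of 1 0] V(5)[of 0] V(5)[of 1] by simp_all
  have "pair_circuit 7 V"
    by (rule pair_circuit_diagonal[OF unitary_mat_carrier[OF V(1)] unitary_mat_zero_pattern[OF V(1) zV V(2)]])
  then have "pair_circuit (6 + (6 + (6 + (6 + (6 + (6 + 7)))))) U"
    by (intro A(3) B(3) C(3) D(3) E(3) V(3))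
  then show ?thesis by simp
qed

text \<open>The constant is 43 gates on the pair times the price \<open>1152 * n ^ 3\<close> of a
  controlled-Z gate on an arbitrary pair.\<close>

lemma reachable_gate:
  assumes n: "even n" and G: "one_or_two_qubit_gate n G"
  shows "reachable n (49536 * n ^ 3) G"
proof -
  have le: "12 * n \<le> 1152 * n ^ 3"
  proof -
    have "n \<le> n ^ 3" by (cases n) (auto simp: power3_eq_cube)
    then show ?thesis by simp
  qed
  consider i U where "i \<in> {1..n}" "unitary_mat 2 U" "G = on_qubits n [i] U"
    | i j U where "i \<in> {1..n}" "j \<in> {1..n}" "i \<noteq> j" "unitary_mat 4 U" "G = on_qubits n [i, j] U"
    using G unfolding one_or_two_qubit_gate_def by blast
  then show ?thesis
  proof cases
    case 1
    have "reachable n (12 * n) G" unfolding 1(3) by (rule reachable_one_qubit[OF 1(1,2)])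
    then show ?thesis by (rule reachable_mono) (use le in simp)
  next
    case 2
    have "reachable n (43 * (1152 * n ^ 3)) G" unfolding 2(5)
      by (rule reachable_pair_circuit[OF 2(1-3) reachable_controlled_z[OF n 2(1-3)] le pair_circuit_unitary[OF 2(4)]])
    then show ?thesis by simp
  qed
qed

theorem theoremS3:
  shows "\<exists>r :: real poly poly. \<forall>(n :: nat) (s :: nat) (V :: complex mat) (Gs :: complex mat list).
    even n \<longrightarrow> unitary_mat (2 ^ n) V \<longrightarrow>
    length Gs = s \<longrightarrow> (\<forall>G \<in> set Gs. one_or_two_qubit_gate n G) \<longrightarrow> V = mat_prod_list (2 ^ n) Gs \<longrightarrow>
    (\<exists>(L :: nat) (\<alpha> :: nat \<Rightarrow> nat \<Rightarrow> real) (\<phi> :: real).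
       real L \<le> eval_poly2 r (real n) (real s) \<and>
       brickwork n \<alpha> L = cis \<phi> \<cdot>\<^sub>m V)"
proof (intro exI[of _ "[:0, monom 49536 3:]"] allI impI)
  fix n s V Gs
  assume n: "even (n :: nat)" and s: "length Gs = (s :: nat)"
    and Gs: "\<forall>G \<in> set Gs. one_or_two_qubit_gate n G" and V: "V = mat_prod_list (2 ^ n) Gs"
  have "reachable n (length Gs * (49536 * n ^ 3)) V"
    unfolding V by (rule reachable_mat_prod_list) (use Gs reachable_gate[OF n] in blast)
  then obtain L \<alpha> \<phi> where L: "L \<le> s * (49536 * n ^ 3)" "brickwork n \<alpha> L = cis \<phi> \<cdot>\<^sub>m V"
    unfolding reachable_def s by blast
  \<comment> \<open>The polynomial has the number of gates as outer variable, linearly, with the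
    price of one gate as its coefficient.\<close>
  have "real L \<le> real (s * (49536 * n ^ 3))" using L(1) by (rule of_nat_mono)
  also have "\<dots> = eval_poly2 [:0, monom 49536 3:] (real n) (real s)"
    by (simp add: eval_poly2_def poly_monom)
  finally show "\<exists>L \<alpha> \<phi>. real L \<le> eval_poly2 [:0, monom 49536 3:] (real n) (real s) \<and> brickwork n \<alpha> L = cis \<phi> \<cdot>\<^sub>m V"
    using L(2) by blast
qed

end
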